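(* Let $R$ be an sQQR-domain with Noetherian spectrum. Then $R$ is a Prüfer domain.
   Context: Let $R$ be an integral domain with quotient field $K$. $R$ is an sQQR-domain if each simple overring of $R$, i.e., each ring $R[u]$ with $u \in K$, is an intersection of localizations of $R$, i.e., equals $\bigcap_{P \in \mathcal P} R_P$ for some set $\mathcal P$ of prime ideals of $R$. $R$ has Noetherian spectrum if it satisfies the ascending chain condition on radical ideals. *)

theory Defs
  imports "HOL-Algebra.Algebra"
begin

text \<open>
  An integral domain is given together with its quotient field: \<open>K\<close> is a field, and the
  domain is a subset \<open>R\<close> of its carrier, so that overrings of \<open>R\<close> are subsets of
  \<^term>\<open>carrier K\<close>. Intrinsic ring-theoretic notions (ideals, prime ideals, generated
  ideals) refer to the ring \<^term>\<open>K\<lparr>carrier := R\<rparr>\<close>. Throughout, \<open>inv\<^bsub>K\<^esub>\<close> is the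
  multiplicative inverse in the field.
\<close>

definition domain_with_quotient_field :: "('a, 'b) ring_scheme \<Rightarrow> 'a set \<Rightarrow> bool" where
  "domain_with_quotient_field K R \<longleftrightarrow>
     field K \<and> subring R K \<and>
     (\<forall>x\<in>carrier K. \<exists>a\<in>R. \<exists>b\<in>R - {\<zero>\<^bsub>K\<^esub>}. x = a \<otimes>\<^bsub>K\<^esub> inv\<^bsub>K\<^esub> b)"

definition localization_at :: "('a, 'b) ring_scheme \<Rightarrow> 'a set \<Rightarrow> 'a set \<Rightarrow> 'a set" where
  "localization_at K R P = {a \<otimes>\<^bsub>K\<^esub> inv\<^bsub>K\<^esub> s | a s. a \<in> R \<and> s \<in> R - P}"

text \<open>
  The library's \<^const>\<open>ring.simple_extension\<close> is the ring \<open>R[u]\<close>: the values at \<open>u\<close> of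
  polynomials over \<open>R\<close>, in Horner form. Intersecting with \<^term>\<open>carrier K\<close> only matters
  for \<open>\<P> = {}\<close>, where the intersection of subsets of \<open>K\<close> is \<open>K\<close> (which is also the
  localization at the zero ideal).
\<close>

definition sQQR_domain :: "('a, 'b) ring_scheme \<Rightarrow> 'a set \<Rightarrow> bool" where
  "sQQR_domain K R \<longleftrightarrow>
     domain_with_quotient_field K R \<and>
     (\<forall>u\<in>carrier K. \<exists>\<P>. (\<forall>P\<in>\<P>. primeideal P (K\<lparr>carrier := R\<rparr>)) \<and>
        ring.simple_extension K R u = carrier K \<inter> (\<Inter>P\<in>\<P>. localization_at K R P))"

definition radical_of :: "('a, 'b) ring_scheme \<Rightarrow> 'a set \<Rightarrow> 'a set" where
  "radical_of S I = {x \<in> carrier S. \<exists>n::nat. n > 0 \<and> x [^]\<^bsub>S\<^esub> n \<in> I}"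

definition radical_ideal :: "'a set \<Rightarrow> ('a, 'b) ring_scheme \<Rightarrow> bool" where
  "radical_ideal I S \<longleftrightarrow> ideal I S \<and> radical_of S I = I"

definition noetherian_spectrum :: "('a, 'b) ring_scheme \<Rightarrow> bool" where
  "noetherian_spectrum S \<longleftrightarrow>
     (\<forall>I :: nat \<Rightarrow> 'a set.
        (\<forall>n. radical_ideal (I n) S) \<and> (\<forall>n. I n \<subseteq> I (Suc n)) \<longrightarrow>
        (\<exists>N. \<forall>n\<ge>N. I n = I N))"

text \<open>The fractional ideal \<open>I\<inverse> = (R :\<^sub>K I)\<close>.\<close>

definition fractional_inverse :: "('a, 'b) ring_scheme \<Rightarrow> 'a set \<Rightarrow> 'a set \<Rightarrow> 'a set" where
  "fractional_inverse K R I = {x \<in> carrier K. \<forall>a\<in>I. x \<otimes>\<^bsub>K\<^esub> a \<in> R}"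

text \<open>
  \<^term>\<open>I \<cdot>\<^bsub>K\<^esub> J\<close> is the set of finite sums of products taken in \<open>K\<close>, that is, the product
  of fractional ideals; neither factor need be an ideal of \<open>K\<close> itself.
\<close>

definition invertible_ideal :: "('a, 'b) ring_scheme \<Rightarrow> 'a set \<Rightarrow> 'a set \<Rightarrow> bool" where
  "invertible_ideal K R I \<longleftrightarrow> I \<cdot>\<^bsub>K\<^esub> fractional_inverse K R I = R"

text \<open>A Pruefer domain: every nonzero finitely generated ideal is invertible.\<close>

definition pruefer_domain :: "('a, 'b) ring_scheme \<Rightarrow> 'a set \<Rightarrow> bool" where
  "pruefer_domain K R \<longleftrightarrow>
     domain_with_quotient_field K R \<and>
     (\<forall>A. finite A \<and> A \<subseteq> R \<and> Idl\<^bsub>K\<lparr>carrier := R\<rparr>\<^esub> A \<noteq> {\<zero>\<^bsub>K\<^esub>} \<longrightarrow>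
        invertible_ideal K R (Idl\<^bsub>K\<lparr>carrier := R\<rparr>\<^esub> A))"

end

theory Submission
  imports Defs
begin

text \<open>
  Put \<open>C\<^sub>x = (R :\<^sub>R x)\<close>. A localization \<open>R\<^sub>P\<close> contains \<open>x\<close> iff \<open>C\<^sub>x\<close> is not contained in \<open>P\<close>, so the
  sQQR property says that \<open>C\<^sub>x \<subseteq> \<surd>C\<^sub>y\<close> implies \<open>y \<in> R[x]\<close>. As radicals of ideals of \<open>R\<close> are
  radicals of finitely generated ideals, this passes to localizations at maximal ideals, and it
  suffices to show that a local such \<open>R\<close>, with maximal ideal \<open>P\<close>, is a valuation ring.

  Suppose that \<open>u\<close> and \<open>1/u\<close> are not in \<open>R\<close>, and let \<open>T\<close> be the set of all \<open>t\<close> with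
  \<open>P \<subseteq> \<surd>C\<^sub>t\<close>. Then \<open>T \<subseteq> R[x]\<close> for every \<open>x \<notin> R\<close>. Nakayama's lemma, applied to the span of
  powers of \<open>u\<close>, gives \<open>1/q \<notin> T\<close> for \<open>q \<in> P\<close>, and then that \<open>T\<close> is integral over \<open>R\<close> and
  \<open>P T \<subseteq> P\<close>. If \<open>x \<notin> T\<close>, prime avoidance gives \<open>p \<in> P\<close> that is regular modulo \<open>\<surd>C\<^sub>x\<close>, so
  \<open>x \<in> R[p x]\<close>. For \<open>x\<close> integral over \<open>T\<close> this contradicts Nakayama's lemma, so \<open>T\<close> is integrally
  closed. For arbitrary \<open>x\<close> it is an equation with a unit as linear coefficient, from which one reads
  off that \<open>T\<close> is a Pruefer domain. But \<open>P\<close> is the radical of a finite set \<open>J\<close>, so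
  \<open>(T : J) = T\<close>, and invertibility of \<open>J T\<close> yields \<open>1 \<in> J T \<subseteq> P\<close>.
\<close>

section \<open>Rings with Noetherian spectrum\<close>

context cring
begin

section \<open>Radicals of ideals\<close>

lemma ideal_subset_carrier:
  assumes "ideal I R" shows "I \<subseteq> carrier R"
  using assms ideal.Icarr by fastforce

text \<open>Splitting off one factor \<open>x \<oplus> y\<close> and absorbing its \<open>x\<close>
  or \<open>y\<close> into \<open>a\<close> lowers \<open>n\<close> or \<open>m\<close>. The factor
  \<open>a\<close> thus lets induction on \<open>n + m\<close> replace the binomial theorem.\<close>

lemma radical_add_aux:
  assumes "ideal I R" "x \<in> carrier R" "y \<in> carrier R" "a \<in> carrier R"
    and "x [^] (n::nat) \<otimes> a \<in> I" "y [^] (m::nat) \<otimes> a \<in> I"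
  shows "(x \<oplus> y) [^] (n + m) \<otimes> a \<in> I"
  using assms(4-)
proof (induction "n + m" arbitrary: n m a rule: less_induct)
  case less
  interpret I: ideal I R by fact
  show ?case
  proof (cases "n = 0 \<or> m = 0")
    case True
    then have "a \<in> I" using less.prems by auto
    then show ?thesis using assms(2,3) by (simp add: I.I_l_closed)
  next
    case False
    then obtain n' m' where nm: "n = Suc n'" "m = Suc m'"
      by (metis not0_implies_Suc)
    note c = assms(2,3) less.prems(1)
    have "x [^] n' \<otimes> (x \<otimes> a) \<in> I" "y [^] m \<otimes> (x \<otimes> a) \<in> I"
         "x [^] n \<otimes> (y \<otimes> a) \<in> I" "y [^] m' \<otimes> (y \<otimes> a) \<in> I"
      using less.prems I.I_l_closed[OF less.prems(2) \<open>y \<in> carrier R\<close>]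
        I.I_l_closed[OF less.prems(3) \<open>x \<in> carrier R\<close>] c
      by (simp_all add: nm m_ac)
    then have "(x \<oplus> y) [^] (n' + m) \<otimes> (x \<otimes> a) \<in> I" "(x \<oplus> y) [^] (n + m') \<otimes> (y \<otimes> a) \<in> I"
      using less.hyps[of n' m "x \<otimes> a"] less.hyps[of n m' "y \<otimes> a"] c by (simp_all add: nm)
    then have "(x \<oplus> y) [^] (n' + m) \<otimes> (x \<otimes> a) \<oplus> (x \<oplus> y) [^] (n + m') \<otimes> (y \<otimes> a) \<in> I"
      by simp
    moreover have "(x \<oplus> y) [^] (n + m) \<otimes> a =
        (x \<oplus> y) [^] (n' + m) \<otimes> (x \<otimes> a) \<oplus> (x \<oplus> y) [^] (n + m') \<otimes> (y \<otimes> a)"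
      using c by (simp add: nm l_distr r_distr m_ac)
    ultimately show ?thesis by simp
  qed
qed

lemma radical_of_subset:
  assumes "ideal I R" shows "I \<subseteq> radical_of R I"
proof
  fix x assume "x \<in> I"
  moreover have "x \<in> carrier R" using \<open>x \<in> I\<close> ideal_subset_carrier[OF assms] by auto
  ultimately have "x [^] (1::nat) \<in> I" by simp
  then show "x \<in> radical_of R I" using \<open>x \<in> carrier R\<close>
    unfolding radical_of_def by (intro CollectI conjI exI[of _ 1]) auto
qed

lemma radical_of_mono: "I \<subseteq> J \<Longrightarrow> radical_of R I \<subseteq> radical_of R J"
  unfolding radical_of_def by auto

lemma radical_of_ideal:
  assumes "ideal I R" shows "ideal (radical_of R I) R"
proof (rule idealI)
  interpret I: ideal I R by fact
  show "ring R" by unfold_locales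
  have sub: "radical_of R I \<subseteq> carrier R" unfolding radical_of_def by auto
  show lc: "x \<otimes> a \<in> radical_of R I" "a \<otimes> x \<in> radical_of R I"
    if a: "a \<in> radical_of R I" and x: "x \<in> carrier R" for a x
  proof -
    obtain n :: nat where n: "n > 0" "a [^] n \<in> I" and ac: "a \<in> carrier R"
      using a unfolding radical_of_def by auto
    have "(x \<otimes> a) [^] n = x [^] n \<otimes> a [^] n" using x ac by (simp add: nat_pow_distrib)
    then have "(x \<otimes> a) [^] n \<in> I" using n x by (simp add: I.I_l_closed)
    then show "x \<otimes> a \<in> radical_of R I" using n x ac unfolding radical_of_def by auto
    then show "a \<otimes> x \<in> radical_of R I" using x ac by (simp add: m_comm)
  qed
  show "subgroup (radical_of R I) (add_monoid R)"
  proof (rule group.subgroupI)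
    show "group (add_monoid R)" using a_group .
    show "radical_of R I \<subseteq> carrier (add_monoid R)" using sub by simp
    show "radical_of R I \<noteq> {}" using radical_of_subset[OF assms] I.zero_closed by blast
    fix a b assume ab: "a \<in> radical_of R I" "b \<in> radical_of R I"
    then have "\<ominus> \<one> \<otimes> a \<in> radical_of R I" using lc by simp
    then show "inv\<^bsub>add_monoid R\<^esub> a \<in> radical_of R I"
      using ab sub by (auto simp: a_inv_def[symmetric] l_minus)
    obtain n m :: nat where "n > 0" "a [^] n \<in> I" "b [^] m \<in> I"
      using ab unfolding radical_of_def by auto
    moreover have "a \<in> carrier R" "b \<in> carrier R" using ab sub by auto
    ultimately have "(a \<oplus> b) [^] (n + m) \<otimes> \<one> \<in> I"
      by (intro radical_add_aux[OF assms]) auto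
    then show "a \<otimes>\<^bsub>add_monoid R\<^esub> b \<in> radical_of R I"
      using \<open>n > 0\<close> \<open>a \<in> carrier R\<close> \<open>b \<in> carrier R\<close> unfolding radical_of_def
      by (intro CollectI conjI exI[of _ "n + m"]) auto
  qed
qed

lemma radical_idealI:
  assumes "ideal I R"
    and "\<And>x n. x \<in> carrier R \<Longrightarrow> n > 0 \<Longrightarrow> x [^] (n::nat) \<in> I \<Longrightarrow> x \<in> I"
  shows "radical_ideal I R"
  using assms radical_of_subset[OF assms(1)] unfolding radical_ideal_def radical_of_def by auto

lemma radical_of_radical_ideal:
  assumes "ideal I R" shows "radical_ideal (radical_of R I) R"
proof (rule radical_idealI[OF radical_of_ideal[OF assms]])
  fix x and n :: nat assume x: "x \<in> carrier R" "n > 0" "x [^] n \<in> radical_of R I"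
  then obtain m :: nat where "m > 0" "(x [^] n) [^] m \<in> I"
    unfolding radical_of_def by auto
  then have "x [^] (n * m) \<in> I" "n * m > 0" using x by (simp_all add: nat_pow_pow)
  then show "x \<in> radical_of R I" using x(1) unfolding radical_of_def by blast
qed

lemma radical_of_minimal:
  assumes "radical_ideal A R" "I \<subseteq> A" shows "radical_of R I \<subseteq> A"
  using assms radical_of_mono unfolding radical_ideal_def by metis

lemma radical_ideal_powD:
  assumes "radical_ideal A R" "x \<in> carrier R" "x [^] (n::nat) \<in> A" "n > 0" shows "x \<in> A"
  using assms unfolding radical_ideal_def radical_of_def by auto

section \<open>Consequences of the chain condition on radical ideals\<close>

lemma noetherian_spectrum_maximal:
  assumes "noetherian_spectrum R" "\<A> \<noteq> {}" "\<And>A. A \<in> \<A> \<Longrightarrow> radical_ideal A R"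
  obtains A where "A \<in> \<A>" "\<And>B. B \<in> \<A> \<Longrightarrow> A \<subseteq> B \<Longrightarrow> B = A"
proof (rule ccontr)
  assume "\<not> thesis"
  with that have step: "\<exists>B\<in>\<A>. A \<subset> B" if "A \<in> \<A>" for A
    using \<open>A \<in> \<A>\<close> by blast
  obtain A0 where "A0 \<in> \<A>" using assms(2) by auto
  obtain I :: "nat \<Rightarrow> 'a set" where I: "\<And>n. I n \<in> \<A> \<and> I n \<subset> I (Suc n)"
    using dependent_nat_choice[of "\<lambda>_ A. A \<in> \<A>" "\<lambda>_ A B. A \<subset> B"] step \<open>A0 \<in> \<A>\<close> by metis
  then have "\<exists>N. \<forall>n\<ge>N. I n = I N"
    using assms(1,3) unfolding noetherian_spectrum_def by (metis psubset_imp_subset)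
  then show False using I by (metis le_Suc_eq order_refl psubset_eq)
qed

text \<open>The radical of a proper ideal is proper, so a maximal element among the proper radical
  ideals above \<open>I\<close> has no proper ideal strictly above it. The chain condition stands in
  for Zorn's lemma.\<close>

lemma noetherian_spectrum_maximalideal:
  assumes ns: "noetherian_spectrum R" and I: "ideal I R" "I \<noteq> carrier R"
  obtains M where "maximalideal M R" "I \<subseteq> M"
proof -
  define \<A> where "\<A> = {A. radical_ideal A R \<and> A \<noteq> carrier R \<and> I \<subseteq> A}"
  have proper: "radical_of R J \<noteq> carrier R" if J: "ideal J R" "J \<noteq> carrier R" for J
  proof
    assume "radical_of R J = carrier R"
    then have "\<one> \<in> radical_of R J" by simp
    then have "\<one> \<in> J" unfolding radical_of_def by auto
    then show False using ideal.one_imp_carrier[OF J(1)] J(2) by simp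
  qed
  have "radical_of R I \<in> \<A>"
    unfolding \<A>_def using radical_of_radical_ideal[OF I(1)] proper[OF I] radical_of_subset[OF I(1)] by auto
  then have "\<A> \<noteq> {}" by auto
  moreover have "radical_ideal A R" if "A \<in> \<A>" for A using that unfolding \<A>_def by simp
  ultimately obtain M where M: "M \<in> \<A>" and max: "\<And>B. B \<in> \<A> \<Longrightarrow> M \<subseteq> B \<Longrightarrow> B = M"
    by (rule noetherian_spectrum_maximal[OF ns]) blast+
  have iM: "ideal M R" using M unfolding \<A>_def radical_ideal_def by auto
  have "maximalideal M R"
  proof (rule maximalidealI[OF iM])
    show "carrier R \<noteq> M" using M unfolding \<A>_def by auto
    fix J assume J: "ideal J R" "M \<subseteq> J" "J \<subseteq> carrier R"
    show "J = M \<or> J = carrier R"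
    proof (rule disjCI)
      assume ne: "J \<noteq> carrier R"
      have sub: "J \<subseteq> radical_of R J" using radical_of_subset[OF J(1)] .
      then have "radical_of R J \<in> \<A>"
        using radical_of_radical_ideal[OF J(1)] proper[OF J(1) ne] M J unfolding \<A>_def by auto
      then show "J = M" using max sub J(2) by blast
    qed
  qed
  then show ?thesis using that M unfolding \<A>_def by auto
qed

text \<open>Among the radicals of ideals generated by finite subsets of \<open>A\<close> take a
  maximal one. Adjoining an element of \<open>A\<close> to its generators cannot enlarge it, so it
  contains \<open>A\<close>.\<close>

lemma noetherian_spectrum_finite_radical:
  assumes ns: "noetherian_spectrum R" and A: "ideal A R"
  obtains J where "finite J" "J \<subseteq> A" "A \<subseteq> radical_of R (Idl J)"
proof -
  define \<A> where "\<A> = {radical_of R (Idl J) |J. finite J \<and> J \<subseteq> A}"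
  have Ac: "A \<subseteq> carrier R" using ideal_subset_carrier[OF A] .
  have gen: "ideal (Idl J) R" if "J \<subseteq> A" for J using genideal_ideal that Ac by auto
  have "\<A> \<noteq> {}" unfolding \<A>_def by blast
  moreover have "radical_ideal B R" if "B \<in> \<A>" for B
    using that radical_of_radical_ideal gen unfolding \<A>_def by auto
  ultimately obtain B where B: "B \<in> \<A>" and max: "\<And>C. C \<in> \<A> \<Longrightarrow> B \<subseteq> C \<Longrightarrow> C = B"
    using noetherian_spectrum_maximal[OF ns] by metis
  then obtain J where J: "finite J" "J \<subseteq> A" "B = radical_of R (Idl J)" unfolding \<A>_def by auto
  have "A \<subseteq> B"
  proof
    fix a assume a: "a \<in> A"
    then have JA: "insert a J \<subseteq> A" "insert a J \<subseteq> carrier R" using J Ac by auto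
    then have "Idl J \<subseteq> Idl (insert a J)"
      by (intro genideal_minimal gen) (use genideal_self[OF JA(2)] in auto)
    then have "B \<subseteq> radical_of R (Idl (insert a J))" unfolding J(3) by (rule radical_of_mono)
    moreover have "radical_of R (Idl (insert a J)) \<in> \<A>" using J JA unfolding \<A>_def by blast
    ultimately have "radical_of R (Idl (insert a J)) = B" using max by blast
    moreover have "a \<in> Idl (insert a J)" using genideal_self[OF JA(2)] by auto
    ultimately show "a \<in> B" using radical_of_subset[OF gen[OF JA(1)]] by auto
  qed
  then show ?thesis using that J by auto
qed

text \<open>Noetherian induction: a maximal counterexample \<open>B\<close> is not prime, so
  \<open>a \<otimes> b \<in> B\<close> with neither factor in \<open>B\<close>. Then
  \<open>B\<close> is the intersection of the radicals of \<open>B + (a)\<close> and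
  \<open>B + (b)\<close>, and both of these decompose.\<close>

lemma noetherian_spectrum_finite_primes:
  assumes ns: "noetherian_spectrum R" and A: "radical_ideal A R"
  obtains F where "finite F" "\<And>Q. Q \<in> F \<Longrightarrow> primeideal Q R" "A = carrier R \<inter> \<Inter>F"
proof -
  define dec where "dec A \<longleftrightarrow> (\<exists>F. finite F \<and> (\<forall>Q\<in>F. primeideal Q R) \<and> A = carrier R \<inter> \<Inter>F)" for A
  have "dec A"
  proof (rule ccontr)
    assume "\<not> dec A"
    then have "{A. radical_ideal A R \<and> \<not> dec A} \<noteq> {}" using A by auto
    then obtain B where B': "B \<in> {A. radical_ideal A R \<and> \<not> dec A}"
      and max': "\<And>C. C \<in> {A. radical_ideal A R \<and> \<not> dec A} \<Longrightarrow> B \<subseteq> C \<Longrightarrow> C = B"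
      by (rule noetherian_spectrum_maximal[OF ns]) blast+
    have B: "radical_ideal B R" "\<not> dec B" using B' by auto
    have max: "\<And>C. radical_ideal C R \<Longrightarrow> \<not> dec C \<Longrightarrow> B \<subseteq> C \<Longrightarrow> C = B"
      using max' by blast
    have iB: "ideal B R" using B(1) unfolding radical_ideal_def by simp
    interpret B: ideal B R by fact
    have Bc: "B \<subseteq> carrier R" using ideal_subset_carrier[OF iB] .
    \<comment> \<open>The whole ring is the empty intersection; this is the case for which
      \<open>dec\<close> intersects with \<open>carrier R\<close>.\<close>
    have "dec (carrier R)" unfolding dec_def by (intro exI[of _ "{}"]) auto
    then have "carrier R \<noteq> B" using B by auto
    moreover have "\<not> primeideal B R"
    proof
      assume "primeideal B R"
      then have "dec B" using Bc unfolding dec_def by (intro exI[of _ "{B}"]) auto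
      then show False using B by simp
    qed
    ultimately obtain a b where ab: "a \<in> carrier R" "b \<in> carrier R" "a \<otimes> b \<in> B" "a \<notin> B" "b \<notin> B"
      using primeidealI[OF iB is_cring] by blast
    \<comment> \<open>\<open>C\<close> is the radical of \<open>D = B + (c)\<close>; it decomposes
      because it is strictly larger than \<open>B\<close>.\<close>
    have ext: "\<exists>C. dec C \<and> B \<subseteq> C \<and> (\<forall>r\<in>C. \<exists>k::nat. k > 0 \<and> (\<exists>s\<in>carrier R. \<exists>y\<in>B. r [^] k = y \<oplus> s \<otimes> c))"
      if c: "c \<in> carrier R" "c \<notin> B" for c
    proof -
      define D where "D = set_add R B (PIdl c)"
      have iD: "ideal D R" unfolding D_def using iB cgenideal_ideal[OF c(1)] add_ideals by blast
      have D: "D = {y \<oplus> s \<otimes> c |y s. y \<in> B \<and> s \<in> carrier R}"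
        unfolding D_def set_add_defs cgenideal_def by auto
      have "B \<subseteq> D"
      proof
        fix y assume "y \<in> B"
        then have "y = y \<oplus> \<zero> \<otimes> c" using c Bc by auto
        then show "y \<in> D" unfolding D using \<open>y \<in> B\<close> by blast
      qed
      have "c = \<zero> \<oplus> \<one> \<otimes> c" using c by simp
      then have "c \<in> D" unfolding D using B.zero_closed by blast
      have "D \<subseteq> radical_of R D" using radical_of_subset[OF iD] .
      then have "dec (radical_of R D)"
        using max[OF radical_of_radical_ideal[OF iD]] \<open>B \<subseteq> D\<close> \<open>c \<in> D\<close> c(2) by blast
      moreover have "\<exists>k::nat. k > 0 \<and> (\<exists>s\<in>carrier R. \<exists>y\<in>B. r [^] k = y \<oplus> s \<otimes> c)"
        if "r \<in> radical_of R D" for r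
        using that unfolding radical_of_def D by blast
      ultimately show ?thesis using \<open>B \<subseteq> D\<close> \<open>D \<subseteq> radical_of R D\<close> by (intro exI[of _ "radical_of R D"]) auto
    qed
    obtain C1 where C1: "dec C1" "B \<subseteq> C1"
      "\<And>r. r \<in> C1 \<Longrightarrow> \<exists>k::nat. k > 0 \<and> (\<exists>s\<in>carrier R. \<exists>y\<in>B. r [^] k = y \<oplus> s \<otimes> a)"
      using ext[OF ab(1,4)] by blast
    obtain C2 where C2: "dec C2" "B \<subseteq> C2"
      "\<And>r. r \<in> C2 \<Longrightarrow> \<exists>k::nat. k > 0 \<and> (\<exists>s\<in>carrier R. \<exists>y\<in>B. r [^] k = y \<oplus> s \<otimes> b)"
      using ext[OF ab(2,5)] by blast
    have "dec (C1 \<inter> C2)"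
    proof -
      obtain F1 F2 where "finite F1" "\<forall>Q\<in>F1. primeideal Q R" "C1 = carrier R \<inter> \<Inter>F1"
        "finite F2" "\<forall>Q\<in>F2. primeideal Q R" "C2 = carrier R \<inter> \<Inter>F2"
        using C1(1) C2(1) unfolding dec_def by auto
      then show ?thesis unfolding dec_def by (intro exI[of _ "F1 \<union> F2"]) auto
    qed
    moreover have "C1 \<inter> C2 = B"
    proof
      show "B \<subseteq> C1 \<inter> C2" using C1 C2 by auto
      show "C1 \<inter> C2 \<subseteq> B"
      proof
        fix r assume r: "r \<in> C1 \<inter> C2"
        then have rc: "r \<in> carrier R" using C1(1) unfolding dec_def by auto
        obtain k1 s1 y1 where 1: "k1 > (0::nat)" "s1 \<in> carrier R" "y1 \<in> B" "r [^] k1 = y1 \<oplus> s1 \<otimes> a"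
          using C1(3) r by blast
        obtain k2 s2 y2 where 2: "k2 > (0::nat)" "s2 \<in> carrier R" "y2 \<in> B" "r [^] k2 = y2 \<oplus> s2 \<otimes> b"
          using C2(3) r by blast
        have yc: "y1 \<in> carrier R" "y2 \<in> carrier R" using 1 2 Bc by auto
        \<comment> \<open>Every term of the expanded product contains \<open>y1\<close>,
          \<open>y2\<close> or \<open>a \<otimes> b\<close>, so the product lies in
          \<open>B\<close>.\<close>
        have "r [^] (k1 + k2) = (y1 \<oplus> s1 \<otimes> a) \<otimes> (y2 \<oplus> s2 \<otimes> b)"
          using rc 1 2 by (simp add: nat_pow_mult[symmetric])
        also have "\<dots> = (y2 \<oplus> s2 \<otimes> b) \<otimes> y1 \<oplus> ((s1 \<otimes> a) \<otimes> y2 \<oplus> (s1 \<otimes> s2) \<otimes> (a \<otimes> b))"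
          using yc 1(2) 2(2) ab(1,2) by algebra
        also have "\<dots> \<in> B"
          using 1 2 ab yc B.I_l_closed[of y2 "s1 \<otimes> a"]
          by (intro B.a_closed) (auto intro: B.I_l_closed)
        finally show "r \<in> B" using radical_ideal_powD[OF B(1) rc] 1(1) by simp
      qed
    qed
    ultimately show False using B by simp
  qed
  then show ?thesis using that unfolding dec_def by auto
qed

section \<open>Prime avoidance and regular elements\<close>

text \<open>Take from each ideal an element outside \<open>Q\<close>; their product lies in all the
  ideals and, \<open>Q\<close> being prime, stays outside \<open>Q\<close>.\<close>

lemma primeideal_finite_avoid:
  assumes "finite F" "primeideal Q R" "\<And>I. I \<in> F \<Longrightarrow> ideal I R \<and> \<not> I \<subseteq> Q"
  obtains a where "a \<in> carrier R" "a \<notin> Q" "\<And>I. I \<in> F \<Longrightarrow> a \<in> I"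
  using assms(1,3)
proof (induction F arbitrary: thesis)
  case empty
  interpret Q: primeideal Q R by fact
  have "\<one> \<notin> Q" using Q.I_notcarr Q.one_imp_carrier by auto
  then show ?case using empty by auto
next
  case (insert I F)
  interpret Q: primeideal Q R by fact
  obtain a where a: "a \<in> carrier R" "a \<notin> Q" "\<And>I. I \<in> F \<Longrightarrow> a \<in> I"
    using insert.IH insert.prems by blast
  have I: "ideal I R" "\<not> I \<subseteq> Q" using insert.prems by auto
  then obtain b where b: "b \<in> I" "b \<notin> Q" "b \<in> carrier R" using ideal_subset_carrier by auto
  show ?case
  proof (rule insert.prems(1))
    show "a \<otimes> b \<in> carrier R" using a b by simp
    show "a \<otimes> b \<notin> Q" using Q.I_prime a b by blast
    show "a \<otimes> b \<in> J" if "J \<in> insert I F" for J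
    proof (cases "J = I")
      case True then show ?thesis using ideal.I_l_closed[OF I(1)] a b by auto
    next
      case False
      then have "ideal J R" "a \<in> J" using that insert.prems a by auto
      then show ?thesis using ideal.I_r_closed b by metis
    qed
  qed
qed

lemma prime_avoidance:
  assumes "finite F" "\<And>Q. Q \<in> F \<Longrightarrow> primeideal Q R \<and> \<not> I \<subseteq> Q" "ideal I R"
  obtains p where "p \<in> I" "\<And>Q. Q \<in> F \<Longrightarrow> p \<notin> Q"
  using assms(1,2)
proof (induction F arbitrary: thesis)
  case empty
  then show ?case using additive_subgroup.zero_closed ideal.axioms(1)[OF assms(3)] by fast
next
  case (insert Q F)
  have Q: "primeideal Q R" "\<not> I \<subseteq> Q" using insert.prems by auto
  interpret Q: primeideal Q R by fact
  interpret I: ideal I R by fact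
  obtain p where p: "p \<in> I" "\<And>Q. Q \<in> F \<Longrightarrow> p \<notin> Q"
    using insert.IH insert.prems by (metis insertCI)
  show ?case
  proof (cases "p \<in> Q")
    case False
    then show ?thesis using insert.prems(1)[of p] p by auto
  next
    case True
    \<comment> \<open>If \<open>p\<close> falls into the new prime \<open>Q\<close>, it is corrected
      by some \<open>q \<in> I\<close> outside \<open>Q\<close> that lies in every member of
      \<open>F\<close> not contained in \<open>Q\<close>. Each prime to be avoided then either
      contains exactly one of \<open>p\<close> and \<open>q\<close>, or lies inside
      \<open>Q\<close>, which does not contain \<open>p \<oplus> q\<close>.\<close>
    define G where "G = insert I {Q'\<in>F. \<not> Q' \<subseteq> Q}"
    have "finite G" unfolding G_def using insert.hyps by simp
    moreover have "ideal J R \<and> \<not> J \<subseteq> Q" if "J \<in> G" for J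
      using that Q assms(3) insert.prems(2) primeideal.axioms(1) unfolding G_def by blast
    ultimately obtain q where q: "q \<in> carrier R" "q \<notin> Q" "\<And>J. J \<in> G \<Longrightarrow> q \<in> J"
      using primeideal_finite_avoid[OF _ Q(1), of G] by blast
    have pq: "p \<oplus> q \<in> I" using p(1) q(3)[of I] unfolding G_def by auto
    have pc: "p \<in> carrier R" using p(1) I.Icarr by auto
    have *: "p \<oplus> q \<notin> J" if J: "ideal J R" "p \<in> J \<longleftrightarrow> q \<notin> J" for J
    proof
      assume pqJ: "p \<oplus> q \<in> J"
      interpret J: ideal J R by fact
      have eq: "p = (p \<oplus> q) \<oplus> \<ominus> q" "q = (p \<oplus> q) \<oplus> \<ominus> p" using pc q(1) by algebra+
      then have "p \<in> J" if "q \<in> J" by (subst eq(1)) (intro J.a_closed pqJ J.a_inv_closed that)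
      moreover have "q \<in> J" if "p \<in> J" by (subst eq(2)) (intro J.a_closed pqJ J.a_inv_closed that)
      ultimately show False using J(2) by auto
    qed
    show ?thesis
    proof (rule insert.prems(1)[OF pq])
      fix Q' assume "Q' \<in> insert Q F"
      then consider "Q' = Q" | "Q' \<in> F" "Q' \<subseteq> Q" | "Q' \<in> F" "Q' \<in> G" unfolding G_def by auto
      then show "p \<oplus> q \<notin> Q'"
      proof cases
        case 1
        then show ?thesis using *[OF Q.is_ideal] True q by auto
      next
        case 2
        then show ?thesis using *[OF Q.is_ideal] True q by auto
      next
        case 3
        then show ?thesis using * p(2) q(3) insert.prems(2) primeideal.axioms(1) by (metis insertCI)
      qed
    qed
  qed
qed

text \<open>The second hypothesis on \<open>A\<close> says that \<open>A\<close> is contracted from the localization at \<open>M\<close>.\<close>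

lemma noetherian_spectrum_regular_element:
  assumes ns: "noetherian_spectrum R" and M: "maximalideal M R"
    and A: "radical_ideal A R" "\<not> M \<subseteq> A"
    and sat: "\<And>r s. r \<in> carrier R \<Longrightarrow> s \<in> carrier R \<Longrightarrow> s \<notin> M \<Longrightarrow> s \<otimes> r \<in> A \<Longrightarrow> r \<in> A"
  obtains p where "p \<in> M" "\<And>r. r \<in> carrier R \<Longrightarrow> r \<otimes> p \<in> A \<Longrightarrow> r \<in> A"
proof -
  obtain F where F: "finite F" "\<And>Q. Q \<in> F \<Longrightarrow> primeideal Q R" "A = carrier R \<inter> \<Inter>F"
    using noetherian_spectrum_finite_primes[OF ns A(1)] by blast
  have Mp: "primeideal M R" using maximalideal_prime[OF M] .
  interpret M: maximalideal M R by fact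
  \<comment> \<open>The element \<open>p\<close> sought is chosen outside every prime of the
    decomposition that does not contain \<open>M\<close>.\<close>
  define F2 where "F2 = {Q\<in>F. \<not> M \<subseteq> Q}"
  have "finite F2" "\<And>Q. Q \<in> F2 \<Longrightarrow> primeideal Q R \<and> \<not> M \<subseteq> Q"
    using F(1,2) unfolding F2_def by auto
  from prime_avoidance[OF this M.is_ideal] obtain p
    where p: "p \<in> M" "\<And>Q. Q \<in> F2 \<Longrightarrow> p \<notin> Q" by metis
  \<comment> \<open>Multiplication by \<open>s\<close> moves everything into the primes of
    \<open>F\<close> not contained in \<open>M\<close>; as \<open>s \<notin> M\<close>, hypothesis
    \<open>sat\<close> cancels it afterwards.\<close>
  have "finite {Q\<in>F. \<not> Q \<subseteq> M}" "\<And>Q. Q \<in> {Q\<in>F. \<not> Q \<subseteq> M} \<Longrightarrow> ideal Q R \<and> \<not> Q \<subseteq> M"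
    using F(1,2) primeideal.axioms(1) by auto
  from primeideal_finite_avoid[OF this(1) Mp this(2)] obtain s
    where s: "s \<in> carrier R" "s \<notin> M" "\<forall>Q \<in> {Q\<in>F. \<not> Q \<subseteq> M}. s \<in> Q" by metis
  have "r \<in> A" if r: "r \<in> carrier R" "r \<otimes> p \<in> A" for r
  proof -
    have r2: "r \<in> Q" if "Q \<in> F2" for Q
    proof -
      have "Q \<in> F" using that unfolding F2_def by simp
      then have "r \<otimes> p \<in> Q" "primeideal Q R" using F r by auto
      then show ?thesis using primeideal.I_prime[OF _ r(1), of Q p] p that M.Icarr by blast
    qed
    \<comment> \<open>The prime \<open>M\<close> may itself belong to \<open>F\<close>. If some
      member of \<open>F2\<close> lies inside \<open>M\<close>, then \<open>r \<in> M\<close>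
      follows and \<open>M\<close> causes no trouble. Otherwise every prime of \<open>F\<close>
      inside \<open>M\<close> equals \<open>M\<close>, and \<open>M \<subseteq> A\<close>
      contradicts the assumption.\<close>
    show ?thesis
    proof (cases "\<exists>Q\<in>F2. Q \<subseteq> M")
      case True
      then obtain Q1 where Q1: "Q1 \<in> F2" "Q1 \<subseteq> M" by auto
      have "s \<otimes> r \<in> Q" if Q: "Q \<in> F" for Q
      proof -
        have iQ: "ideal Q R" using F(2)[OF Q] primeideal.axioms(1) by blast
        consider "\<not> Q \<subseteq> M" | "Q \<in> F2" | "M = Q" using Q unfolding F2_def by auto
        then show ?thesis
        proof cases
          case 1
          then show ?thesis using s Q ideal.I_r_closed[OF iQ] r by auto
        next
          case 2
          then show ?thesis using r2 ideal.I_l_closed[OF iQ] s by auto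
        next
          case 3
          then show ?thesis using r2[OF Q1(1)] Q1(2) ideal.I_l_closed[OF iQ] s by auto
        qed
      qed
      then have "s \<otimes> r \<in> A" using F(3) s r by auto
      then show ?thesis using sat r s by blast
    next
      case False
      then have nsub: "\<And>Q. Q \<in> F \<Longrightarrow> Q \<subseteq> M \<Longrightarrow> Q = M" unfolding F2_def by auto
      have "M \<subseteq> A"
      proof
        fix m assume m: "m \<in> M"
        then have mc: "m \<in> carrier R" using M.Icarr by auto
        have "s \<otimes> m \<in> Q" if Q: "Q \<in> F" for Q
        proof -
          have iQ: "ideal Q R" using F(2)[OF Q] primeideal.axioms(1) by blast
          consider "\<not> Q \<subseteq> M" | "Q = M" using Q nsub by auto
          then show ?thesis using s Q ideal.I_r_closed[OF iQ _ mc] ideal.I_l_closed[OF iQ _ s(1)] m by cases auto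
        qed
        then have "s \<otimes> m \<in> A" using F(3) s mc by auto
        then show "m \<in> A" using sat mc s by blast
      qed
      then show ?thesis using A by simp
    qed
  qed
  then show ?thesis using that p by blast
qed

end

section \<open>Linear combinations and Nakayama's lemma\<close>

context ring
begin

text \<open>The \<open>S\<close>-span of \<open>G\<close>, built one term at a time. A generator may
  recur, so no family of coefficients has to be carried along.\<close>

inductive_set lincomb :: "'a set \<Rightarrow> 'a set \<Rightarrow> 'a set" for S G where
  zero: "\<zero> \<in> lincomb S G"
| add: "\<lbrakk>s \<in> S; g \<in> G; h \<in> lincomb S G\<rbrakk> \<Longrightarrow> s \<otimes> g \<oplus> h \<in> lincomb S G"

text \<open>For a subring \<open>S\<close> these are the \<open>S\<close>-submodules of the ambient
  ring, negation being multiplication by \<open>\<ominus> \<one>\<close>.\<close>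

definition submod :: "'a set \<Rightarrow> 'a set \<Rightarrow> bool" where
  "submod S N \<longleftrightarrow> N \<subseteq> carrier R \<and> \<zero> \<in> N \<and> (\<forall>a\<in>N. \<forall>b\<in>N. a \<oplus> b \<in> N) \<and> (\<forall>s\<in>S. \<forall>a\<in>N. s \<otimes> a \<in> N)"

lemma submodD:
  assumes "submod S N"
  shows "N \<subseteq> carrier R" "\<zero> \<in> N" "\<lbrakk>a \<in> N; b \<in> N\<rbrakk> \<Longrightarrow> a \<oplus> b \<in> N" "\<lbrakk>s \<in> S; a \<in> N\<rbrakk> \<Longrightarrow> s \<otimes> a \<in> N"
  using assms unfolding submod_def by auto

lemma submod_subring: "subring S R \<Longrightarrow> submod S S"
  unfolding submod_def using subringE by (metis subsetD subsetI)

lemma lincomb_minimal: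
  assumes "submod S N" "G \<subseteq> N" shows "lincomb S G \<subseteq> N"
proof
  fix h assume "h \<in> lincomb S G"
  then show "h \<in> N" by induction (use submodD[OF assms(1)] assms(2) in auto)
qed

lemma lincomb_mono:
  assumes "G \<subseteq> G'" shows "lincomb S G \<subseteq> lincomb S G'"
proof
  fix h assume "h \<in> lincomb S G"
  then show "h \<in> lincomb S G'" by induction (use assms in \<open>auto intro: lincomb.intros\<close>)
qed

lemma lincomb_carrier:
  assumes "S \<subseteq> carrier R" "G \<subseteq> carrier R" shows "lincomb S G \<subseteq> carrier R"
  using assms by (intro lincomb_minimal) (auto simp: submod_def)

lemma lincomb_add:
  assumes "S \<subseteq> carrier R" "G \<subseteq> carrier R" "x \<in> lincomb S G" "y \<in> lincomb S G"
  shows "x \<oplus> y \<in> lincomb S G"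
  using assms(3)
proof induction
  case zero
  then show ?case using assms(4) subsetD[OF lincomb_carrier[OF assms(1,2)] assms(4)] by simp
next
  case (add s g h)
  then have "s \<otimes> g \<oplus> (h \<oplus> y) \<in> lincomb S G" by (auto intro: lincomb.intros)
  moreover have "s \<in> carrier R" "g \<in> carrier R" "h \<in> carrier R" "y \<in> carrier R"
    using add assms lincomb_carrier[OF assms(1,2)] by auto
  ultimately show ?case by (simp add: a_assoc)
qed

lemma lincomb_base:
  assumes "\<one> \<in> S" "G \<subseteq> carrier R" "g \<in> G" shows "g \<in> lincomb S G"
proof -
  have "\<one> \<otimes> g \<oplus> \<zero> \<in> lincomb S G" using assms by (auto intro: lincomb.intros)
  moreover have "g \<in> carrier R" using assms by auto
  ultimately show ?thesis by simp
qed

lemma lincomb_submod: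
  assumes "subring S R" "G \<subseteq> carrier R" shows "submod S (lincomb S G)"
proof -
  note S = subringE[OF assms(1)]
  have "s \<otimes> h \<in> lincomb S G" if "s \<in> S" "h \<in> lincomb S G" for s h
    using that(2)
  proof induction
    case zero
    then show ?case using subsetD[OF S(1) that(1)] by (simp add: lincomb.intros)
  next
    case (add r g h)
    then have "(s \<otimes> r) \<otimes> g \<oplus> s \<otimes> h \<in> lincomb S G" using that S(6) by (auto intro: lincomb.intros)
    moreover have "s \<in> carrier R" "r \<in> carrier R" "g \<in> carrier R" "h \<in> carrier R"
      using add assms lincomb_carrier[OF S(1) assms(2)] S that by auto
    ultimately show ?case by (simp add: m_assoc r_distr)
  qed
  then show ?thesis using lincomb_add[OF S(1) assms(2)] lincomb_carrier[OF S(1) assms(2)]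
    unfolding submod_def by (auto intro: lincomb.intros)
qed

lemma lincomb_insert:
  assumes S: "subring S R" and G: "insert g G \<subseteq> carrier R" and "h \<in> lincomb S (insert g G)"
  obtains s h' where "s \<in> S" "h' \<in> lincomb S G" "h = s \<otimes> g \<oplus> h'"
proof -
  note S' = subringE[OF S]
  have Gc: "G \<subseteq> carrier R" "g \<in> carrier R" using G by auto
  have "\<exists>s\<in>S. \<exists>h'\<in>lincomb S G. h = s \<otimes> g \<oplus> h'"
    using assms(3)
  proof induction
    case zero
    have "\<zero> = \<zero> \<otimes> g \<oplus> \<zero>" using Gc by simp
    then show ?case using S'(2) lincomb.zero by blast
  next
    case (add r x h)
    then obtain s h' where sh: "s \<in> S" "h' \<in> lincomb S G" "h = s \<otimes> g \<oplus> h'" by auto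
    have c: "s \<in> carrier R" "h' \<in> carrier R" "r \<in> carrier R"
      using sh add lincomb_carrier[OF S'(1) Gc(1)] S'(1) by auto
    show ?case
    proof (cases "x = g")
      case True
      then have "r \<otimes> x \<oplus> h = (r \<oplus> s) \<otimes> g \<oplus> h'" using c Gc sh by (simp add: l_distr a_assoc)
      then show ?thesis using sh S'(7)[OF add(1) sh(1)] by blast
    next
      case False
      then have "x \<in> G" using add by auto
      then have "x \<in> carrier R" using Gc by auto
      then have "r \<otimes> x \<oplus> h = s \<otimes> g \<oplus> (r \<otimes> x \<oplus> h')" using c Gc sh by (simp add: a_lcomm)
      then show ?thesis using sh lincomb.add[OF add(1) \<open>x \<in> G\<close> sh(2)] by blast
    qed
  qed
  then show ?thesis using that by blast
qed

end

context cring
begin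

lemma lincomb_mult:
  assumes "subring S R" "G \<subseteq> carrier R" "G' \<subseteq> carrier R" "x \<in> carrier R"
    and "\<And>g. g \<in> G \<Longrightarrow> x \<otimes> g \<in> lincomb S G'" "h \<in> lincomb S G"
  shows "x \<otimes> h \<in> lincomb S G'"
  using assms(6)
proof induction
  case zero
  then show ?case using assms by (auto intro: lincomb.intros)
next
  case (add s g h)
  note S = subringE[OF assms(1)]
  note L = submodD[OF lincomb_submod[OF assms(1,3)]]
  have "s \<otimes> (x \<otimes> g) \<oplus> x \<otimes> h \<in> lincomb S G'" using L add assms(5) by auto
  moreover have "s \<in> carrier R" "g \<in> carrier R" "h \<in> carrier R"
    using add assms lincomb_carrier[OF S(1) assms(2)] S by auto
  ultimately show ?case using assms(4) by (simp add: m_lcomm r_distr)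
qed

text \<open>Hypothesis \<open>inv\<close> places \<open>p\<close> in the Jacobson radical of
  \<open>S\<close>. Generators are eliminated one at a time: the relation for \<open>g\<close> is
  solved for \<open>g\<close> by inverting \<open>\<one> \<ominus> p \<otimes> s\<close>, and
  substituting the result keeps the other relations in the same form with one generator
  fewer.\<close>

lemma nakayama:
  assumes S: "subring S R" and p: "p \<in> S"
    and inv: "\<And>s. s \<in> S \<Longrightarrow> \<exists>v\<in>S. v \<otimes> (\<one> \<ominus> p \<otimes> s) = \<one>"
    and N: "submod S N"
    and G: "finite G" "G \<subseteq> carrier R" "\<And>g. g \<in> G \<Longrightarrow> \<exists>n\<in>N. \<exists>h\<in>lincomb S G. g = n \<oplus> p \<otimes> h"
  shows "G \<subseteq> N"
  using G
proof (induction G)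
  case empty
  then show ?case by simp
next
  case (insert g G)
  note S' = subringE[OF S]
  note N' = submodD[OF N]
  have Gc: "G \<subseteq> carrier R" "g \<in> carrier R" "insert g G \<subseteq> carrier R" using insert.prems by auto
  note L = submodD[OF lincomb_submod[OF S Gc(1)]]
  have pc: "p \<in> carrier R" using subsetD[OF S'(1) p] .
  have "\<exists>n\<in>N. \<exists>h\<in>lincomb S G. g = n \<oplus> p \<otimes> h"
  proof -
    obtain n h0 where n: "n \<in> N" "h0 \<in> lincomb S (insert g G)" "g = n \<oplus> p \<otimes> h0"
      using insert.prems(2)[of g] by auto
    obtain s h where h: "s \<in> S" "h \<in> lincomb S G" "h0 = s \<otimes> g \<oplus> h"
      using lincomb_insert[OF S Gc(3) n(2)] .
    obtain v where v: "v \<in> S" "v \<otimes> (\<one> \<ominus> p \<otimes> s) = \<one>" using inv h by auto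
    have c: "n \<in> carrier R" "s \<in> carrier R" "h \<in> carrier R" "v \<in> carrier R"
      using subsetD[OF N'(1) n(1)] subsetD[OF L(1) h(2)] subsetD[OF S'(1) h(1)] subsetD[OF S'(1) v(1)]
      by auto
    have "g \<ominus> p \<otimes> s \<otimes> g = (n \<oplus> p \<otimes> (s \<otimes> g \<oplus> h)) \<ominus> p \<otimes> s \<otimes> g" using n(3) h(3) by simp
    also have "\<dots> = n \<oplus> p \<otimes> h" using c pc Gc(2) by algebra
    finally have 1: "g \<ominus> p \<otimes> s \<otimes> g = n \<oplus> p \<otimes> h" .
    have "g = (v \<otimes> (\<one> \<ominus> p \<otimes> s)) \<otimes> g" using v Gc by simp
    also have "\<dots> = v \<otimes> (g \<ominus> p \<otimes> s \<otimes> g)" using c pc Gc(2) by algebra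
    also have "\<dots> = v \<otimes> n \<oplus> p \<otimes> (v \<otimes> h)" unfolding 1 using c pc Gc(2) by algebra
    finally show ?thesis using N'(4)[OF v(1) n(1)] L(4)[OF v(1) h(2)] by blast
  qed
  then obtain n h where n: "n \<in> N" "h \<in> lincomb S G" "g = n \<oplus> p \<otimes> h" by auto
  have c: "n \<in> carrier R" "h \<in> carrier R"
    using subsetD[OF N'(1) n(1)] subsetD[OF L(1) n(2)] by auto
  have "G \<subseteq> N"
  proof (rule insert.IH[OF Gc(1)])
    fix g' assume "g' \<in> G"
    then obtain n' h0 where n': "n' \<in> N" "h0 \<in> lincomb S (insert g G)" "g' = n' \<oplus> p \<otimes> h0"
      using insert.prems(2)[of g'] by auto
    obtain s h' where h': "s \<in> S" "h' \<in> lincomb S G" "h0 = s \<otimes> g \<oplus> h'"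
      using lincomb_insert[OF S Gc(3) n'(2)] .
    have c': "n' \<in> carrier R" "s \<in> carrier R" "h' \<in> carrier R"
      using subsetD[OF N'(1) n'(1)] subsetD[OF L(1) h'(2)] subsetD[OF S'(1) h'(1)] by auto
    have "g' = n' \<oplus> p \<otimes> (s \<otimes> (n \<oplus> p \<otimes> h) \<oplus> h')" using n' h' n by simp
    also have "\<dots> = (n' \<oplus> (p \<otimes> s) \<otimes> n) \<oplus> p \<otimes> ((s \<otimes> p) \<otimes> h \<oplus> h')" using c c' pc by algebra
    finally have "g' = (n' \<oplus> (p \<otimes> s) \<otimes> n) \<oplus> p \<otimes> ((s \<otimes> p) \<otimes> h \<oplus> h')" .
    moreover have "n' \<oplus> (p \<otimes> s) \<otimes> n \<in> N"
      using N'(3)[OF n'(1) N'(4)[OF S'(6)[OF p h'(1)] n(1)]] .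
    moreover have "(s \<otimes> p) \<otimes> h \<oplus> h' \<in> lincomb S G"
      using L(3)[OF L(4)[OF S'(6)[OF h'(1) p] n(2)] h'(2)] .
    ultimately show "\<exists>n\<in>N. \<exists>h\<in>lincomb S G. g' = n \<oplus> p \<otimes> h" by blast
  qed
  moreover have "h \<in> N" using lincomb_minimal[OF N \<open>G \<subseteq> N\<close>] n by auto
  then have "g \<in> N" unfolding n(3) using N'(3)[OF n(1) N'(4)[OF p]] by simp
  ultimately show ?case by simp
qed

section \<open>Powers of an element and simple extensions\<close>

definition pows :: "'a \<Rightarrow> nat \<Rightarrow> 'a set" where
  "pows x n = (\<lambda>i. x [^] i) ` {..n}"

lemma pows_carrier: "x \<in> carrier R \<Longrightarrow> pows x n \<subseteq> carrier R"
  unfolding pows_def by auto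

lemma finite_pows: "finite (pows x n)"
  unfolding pows_def by simp

lemma lincomb_pows_mono: "n \<le> m \<Longrightarrow> lincomb S (pows x n) \<subseteq> lincomb S (pows x m)"
  unfolding pows_def by (intro lincomb_mono) auto

lemma lincomb_pows_shift:
  assumes "subring S R" "x \<in> carrier R" "h \<in> lincomb S (pows x n)"
  shows "x [^] i \<otimes> h \<in> lincomb S (pows x (i + n))"
proof (rule lincomb_mult[OF assms(1) _ _ _ _ assms(3)])
  fix g assume "g \<in> pows x n"
  then have "x [^] i \<otimes> g \<in> pows x (i + n)"
    using assms(2) unfolding pows_def by (auto simp: nat_pow_mult)
  then show "x [^] i \<otimes> g \<in> lincomb S (pows x (i + n))"
    using lincomb_base pows_carrier[OF assms(2)] subringE(3)[OF assms(1)] by blast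
qed (use assms pows_carrier in auto)

lemma smult_pow_in_lincomb:
  assumes "subring S R" "x \<in> carrier R" "s \<in> S" "i \<le> n"
  shows "s \<otimes> x [^] i \<in> lincomb S (pows x n)"
proof -
  have "x [^] i \<in> pows x n" using assms unfolding pows_def by auto
  then have "s \<otimes> x [^] i \<oplus> \<zero> \<in> lincomb S (pows x n)" using assms by (intro lincomb.intros) auto
  moreover have "s \<in> carrier R" using assms subringE(1) by blast
  ultimately show ?thesis using assms by simp
qed

lemma simple_extension_imp_lincomb_pows:
  assumes S: "subring S R" and x: "x \<in> carrier R" and y: "y \<in> simple_extension S x"
  obtains n where "y \<in> lincomb S (pows x n)"
proof -
  have "\<exists>n. y \<in> lincomb S (pows x n)"
    using y
  proof induction
    case zero
    then show ?case by (auto intro: lincomb.intros)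
  next
    case (lin k s)
    then obtain n where n: "k \<in> lincomb S (pows x n)" by auto
    note L = submodD[OF lincomb_submod[OF S pows_carrier[OF x]]]
    have "x [^] (1::nat) \<otimes> k \<in> lincomb S (pows x (1 + n))" using lincomb_pows_shift[OF S x n] .
    moreover have "s \<otimes> x [^] (0::nat) \<in> lincomb S (pows x (1 + n))"
      using smult_pow_in_lincomb[OF S x] lin by blast
    moreover have "k \<in> carrier R" "s \<in> carrier R"
      using subsetD[OF L(1) n] subsetD[OF subringE(1)[OF S] lin(2)] by auto
    ultimately have "k \<otimes> x \<oplus> s \<in> lincomb S (pows x (1 + n))"
      using L(3) x by (simp add: m_comm)
    then show ?case by blast
  qed
  then show ?thesis using that by blast
qed

end

context field
begin

lemma inv_nonzero:
  assumes "x \<in> carrier R" "x \<noteq> \<zero>"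
  shows "inv x \<in> carrier R" "x \<otimes> inv x = \<one>" "inv x \<otimes> x = \<one>" "inv x \<noteq> \<zero>" "inv (inv x) = x"
proof -
  have u: "x \<in> Units R" using assms field_Units by auto
  then show 1: "inv x \<in> carrier R" "x \<otimes> inv x = \<one>" "inv x \<otimes> x = \<one>" "inv (inv x) = x" by auto
  show "inv x \<noteq> \<zero>" using 1(2) assms by auto
qed

text \<open>This clears denominators: each Horner step in \<open>inv x\<close> costs one more factor
  \<open>x\<close>.\<close>

lemma simple_extension_inv_imp_lincomb_pows:
  assumes S: "subring S R" and x: "x \<in> carrier R" "x \<noteq> \<zero>" and y: "y \<in> simple_extension S (inv x)"
  obtains n where "x [^] n \<otimes> y \<in> lincomb S (pows x n)"
proof -
  note i = inv_nonzero[OF x]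
  have "\<exists>n. x [^] n \<otimes> y \<in> lincomb S (pows x n)"
    using y
  proof induction
    case zero
    then show ?case using x by (intro exI[of _ 0]) (auto intro: lincomb.intros)
  next
    case (lin k s)
    then obtain n where n: "x [^] n \<otimes> k \<in> lincomb S (pows x n)" by auto
    note L = submodD[OF lincomb_submod[OF S pows_carrier[OF x(1)]]]
    have c: "k \<in> carrier R" "s \<in> carrier R"
      using simple_extension_in_carrier[OF subringE(1)[OF S] i(1)] lin subringE(1)[OF S] by auto
    have "x [^] Suc n \<otimes> (k \<otimes> inv x \<oplus> s) = (x [^] n \<otimes> k) \<otimes> (x \<otimes> inv x) \<oplus> s \<otimes> x [^] Suc n"
      using c x i(1) by (simp add: r_distr m_ac)
    also have "\<dots> = x [^] n \<otimes> k \<oplus> s \<otimes> x [^] Suc n" using c x i by simp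
    also have "\<dots> \<in> lincomb S (pows x (Suc n))"
    proof (rule L(3))
      show "x [^] n \<otimes> k \<in> lincomb S (pows x (Suc n))" using n lincomb_pows_mono[of n "Suc n"] by auto
      show "s \<otimes> x [^] Suc n \<in> lincomb S (pows x (Suc n))"
        using smult_pow_in_lincomb[OF S x(1)] lin by blast
    qed
    finally show ?case by blast
  qed
  then show ?thesis using that by blast
qed

text \<open>Membership of \<open>z\<close> in \<open>S[1/z]\<close> is an equation of integral
  dependence: cleared of denominators, it puts \<open>z [^] Suc n\<close> into the span of the
  powers up to \<open>n\<close>. That span is then stable under \<open>z\<close> and contains
  \<open>S[z]\<close>.\<close>

lemma integral_simple_extension_subset:
  assumes S: "subring S R" and z: "z \<in> carrier R" "z \<noteq> \<zero>" "z \<in> simple_extension S (inv z)"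
  obtains n where "simple_extension S z \<subseteq> lincomb S (pows z n)"
proof -
  obtain n where n: "z [^] n \<otimes> z \<in> lincomb S (pows z n)"
    using simple_extension_inv_imp_lincomb_pows[OF S z] .
  note c = pows_carrier[OF z(1)]
  note L = submodD[OF lincomb_submod[OF S c]]
  have g: "z \<otimes> g \<in> lincomb S (pows z n)" if gz: "g \<in> pows z n" for g
  proof -
    obtain i where i: "i \<le> n" "g = z [^] i" using gz unfolding pows_def by auto
    show ?thesis
    proof (cases "i = n")
      case True
      then show ?thesis using n i z by (simp add: m_comm)
    next
      case False
      then have "z \<otimes> g \<in> pows z n" using i z unfolding pows_def
        by (intro image_eqI[of _ _ "Suc i"]) (auto simp: m_comm)
      then show ?thesis using lincomb_base[OF subringE(3)[OF S] c] by blast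
    qed
  qed
  have "y \<in> lincomb S (pows z n)" if "y \<in> simple_extension S z" for y
    using that
  proof induction
    case zero
    then show ?case by (auto intro: lincomb.intros)
  next
    case (lin k s)
    have "z \<otimes> k \<in> lincomb S (pows z n)" using lincomb_mult[OF S c c z(1) g lin(3)] by blast
    moreover have "s \<otimes> z [^] (0::nat) \<in> lincomb S (pows z n)"
      using smult_pow_in_lincomb[OF S z(1)] lin by blast
    moreover have "k \<in> carrier R" "s \<in> carrier R" using lin L(1) subringE(1)[OF S] by auto
    ultimately show ?case using L(3) z by (simp add: m_comm)
  qed
  then show ?thesis using that by blast
qed

text \<open>Let \<open>t\<close> have degree at most \<open>n\<close> in \<open>u\<close>, and let
  \<open>u [^] m \<otimes> t\<close> have degree at most \<open>m\<close>. The span of the powers up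
  to \<open>m + n\<close> is stable under \<open>t\<close>: for \<open>i \<le> m\<close> the product
  \<open>u [^] i \<otimes> t\<close> has degree at most \<open>i + n\<close>, and for larger
  \<open>i\<close> it has degree at most \<open>i\<close>.\<close>

lemma simple_extension_inv_inter_stable:
  assumes S: "subring S R" and u: "u \<in> carrier R" "u \<noteq> \<zero>"
    and t: "t \<in> simple_extension S u" "t \<in> simple_extension S (inv u)"
  obtains n where "\<And>g. g \<in> pows u n \<Longrightarrow> t \<otimes> g \<in> lincomb S (pows u n)"
proof -
  obtain n where n: "t \<in> lincomb S (pows u n)" using simple_extension_imp_lincomb_pows[OF S u(1) t(1)] .
  obtain m where m: "u [^] m \<otimes> t \<in> lincomb S (pows u m)"
    using simple_extension_inv_imp_lincomb_pows[OF S u t(2)] .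
  have tc: "t \<in> carrier R" using simple_extension_in_carrier[OF subringE(1)[OF S] u(1)] t by auto
  show ?thesis
  proof (rule that)
    fix g assume "g \<in> pows u (m + n)"
    then obtain i where i: "i \<le> m + n" "g = u [^] i" unfolding pows_def by auto
    show "t \<otimes> g \<in> lincomb S (pows u (m + n))"
    proof (cases "i \<le> m")
      case True
      then show ?thesis using lincomb_pows_shift[OF S u(1) n, of i] lincomb_pows_mono[of "i + n" "m + n"] i tc u
        by (auto simp: m_comm)
    next
      case False
      then have "u [^] (i - m) \<otimes> (u [^] m \<otimes> t) = t \<otimes> g"
        using i tc u by (simp add: m_assoc[symmetric] nat_pow_mult) (simp add: m_comm)
      then show ?thesis using lincomb_pows_shift[OF S u(1) m, of "i - m"] False
          lincomb_pows_mono[of "(i - m) + m" "m + n"] i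
        by auto
    qed
  qed
qed

section \<open>Invertibility of finitely generated fractional ideals\<close>

text \<open>Hypothesis \<open>split\<close> expresses invertibility of the fractional ideals
  generated by \<open>\<one>\<close> and \<open>x\<close>. It carries over to more generators by
  induction on \<open>A\<close>, an old product being redistributed over the enlarged set.\<close>

lemma one_in_prod_fractional_inverse:
  assumes S: "subring S R"
    and split: "\<And>x. x \<in> carrier R \<Longrightarrow> x \<noteq> \<zero> \<Longrightarrow> \<exists>s\<in>S. s \<otimes> x \<in> S \<and> (\<one> \<ominus> s) \<otimes> inv x \<in> S"
    and A: "finite A" "A \<noteq> {}" "A \<subseteq> carrier R - {\<zero>}"
  shows "\<one> \<in> A \<cdot> fractional_inverse R S A"
  using A
proof (induction rule: finite_ne_induct)
  case (singleton a)
  then have a: "a \<in> carrier R" "a \<noteq> \<zero>" by auto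
  note i = inv_nonzero[OF a]
  have "inv a \<in> fractional_inverse R S {a}"
    using i subringE(3)[OF S] unfolding fractional_inverse_def by auto
  then have "a \<otimes> inv a \<in> {a} \<cdot> fractional_inverse R S {a}" by (intro ideal_prod.prod) auto
  then show ?case using i by simp
next
  case (insert c A)
  note S' = subringE[OF S]
  have c: "c \<in> carrier R" "c \<noteq> \<zero>" using insert.prems by auto
  note ci = inv_nonzero[OF c]
  define I where "I = fractional_inverse R S (insert c A)"
  have "x \<in> insert c A \<cdot> I" if "x \<in> A \<cdot> fractional_inverse R S A" for x
    using that
  proof induction
    case (prod a b)
    then have a: "a \<in> carrier R" "a \<noteq> \<zero>" and b: "b \<in> carrier R" "\<And>a'. a' \<in> A \<Longrightarrow> b \<otimes> a' \<in> S"
      using insert.prems unfolding fractional_inverse_def by auto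
    note ai = inv_nonzero[OF a]
    have x: "c \<otimes> inv a \<in> carrier R" "c \<otimes> inv a \<noteq> \<zero>" using ai c integral by auto
    \<comment> \<open>Splitting \<open>c / a\<close> turns \<open>a \<otimes> b\<close> into
      \<open>a \<otimes> (b \<otimes> t) \<oplus> c \<otimes> d\<close> with
      \<open>d = b (1 - t) a / c\<close>; both \<open>b \<otimes> t\<close> and \<open>d\<close>
      multiply \<open>insert c A\<close> into \<open>S\<close>.\<close>
    obtain t where t: "t \<in> S" "t \<otimes> (c \<otimes> inv a) \<in> S" "(\<one> \<ominus> t) \<otimes> inv (c \<otimes> inv a) \<in> S"
      using split[OF x] by blast
    have tc: "t \<in> carrier R" using subsetD[OF S'(1) t(1)] .
    have inv_x: "inv (c \<otimes> inv a) = a \<otimes> inv c"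
    proof (rule comm_inv_char)
      have "(c \<otimes> inv a) \<otimes> (a \<otimes> inv c) = (c \<otimes> inv c) \<otimes> (a \<otimes> inv a)" using ai(1) ci(1) a c by (simp add: m_ac)
      then show "(c \<otimes> inv a) \<otimes> (a \<otimes> inv c) = \<one>" unfolding ai(2) ci(2) by simp
    qed (use x ci a in auto)
    have "b \<otimes> t \<otimes> a' \<in> S" if "a' \<in> insert c A" for a'
    proof (cases "a' \<in> A")
      case True
      then have "a' \<in> carrier R" using insert.prems by auto
      then have "b \<otimes> t \<otimes> a' = (b \<otimes> a') \<otimes> t" using b tc by (simp add: m_ac)
      then show ?thesis using b(2)[OF True] t S'(6) by simp
    next
      case False
      then have "a' = c" using that by simp
      have "(b \<otimes> a) \<otimes> (t \<otimes> (c \<otimes> inv a)) = (b \<otimes> t \<otimes> c) \<otimes> (a \<otimes> inv a)"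
        using b a tc c ai(1) by (simp add: m_ac)
      then have "b \<otimes> t \<otimes> c = (b \<otimes> a) \<otimes> (t \<otimes> (c \<otimes> inv a))" using b tc c ai by simp
      then show ?thesis using \<open>a' = c\<close> S'(6) b(2) prod(1) t(2) by simp
    qed
    then have 1: "b \<otimes> t \<in> I" using b tc unfolding I_def fractional_inverse_def by auto
    let ?d = "b \<otimes> ((\<one> \<ominus> t) \<otimes> (a \<otimes> inv c))"
    have dc: "?d \<in> carrier R" using b tc a ci by auto
    have omt: "\<one> \<ominus> t \<in> S" using S'(7)[OF S'(3) S'(5)[OF t(1)]] by (simp add: a_minus_def)
    have omc: "\<one> \<ominus> t \<in> carrier R" using tc by auto
    have cd: "c \<otimes> ?d = a \<otimes> b \<otimes> (\<one> \<ominus> t)"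
    proof -
      have "c \<otimes> ?d = (a \<otimes> b \<otimes> (\<one> \<ominus> t)) \<otimes> (c \<otimes> inv c)" using b omc a c ci(1) by (simp add: m_ac)
      then show ?thesis using b omc a c ci by simp
    qed
    have "?d \<otimes> a' \<in> S" if "a' \<in> insert c A" for a'
    proof (cases "a' \<in> A")
      case True
      then have "a' \<in> carrier R" using insert.prems by auto
      then have "?d \<otimes> a' = (b \<otimes> a') \<otimes> ((\<one> \<ominus> t) \<otimes> (a \<otimes> inv c))" using b omc a ci(1) by (simp add: m_ac)
      then show ?thesis using b(2)[OF True] t(3) S'(6) unfolding inv_x by simp
    next
      case False
      then have "a' = c" using that by simp
      then have "?d \<otimes> a' = (b \<otimes> a) \<otimes> (\<one> \<ominus> t)" using cd dc c a b omc by (simp add: m_comm)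
      then show ?thesis using S'(6) b(2) prod(1) omt by simp
    qed
    then have 2: "?d \<in> I" using dc unfolding I_def fractional_inverse_def by auto
    have "a \<otimes> (b \<otimes> t) \<oplus> c \<otimes> ?d = a \<otimes> b" unfolding cd using a b tc by algebra
    moreover have "a \<otimes> (b \<otimes> t) \<oplus> c \<otimes> ?d \<in> insert c A \<cdot> I"
      using 1 2 prod(1) by (intro ideal_prod.sum ideal_prod.prod) auto
    ultimately show ?case by simp
  next
    case (sum s1 s2)
    then show ?case by (auto intro: ideal_prod.sum)
  qed
  then show ?case using insert unfolding I_def by auto
qed

end

section \<open>The local case\<close>

lemma (in ring) simple_extension_split:
  assumes "y \<in> simple_extension S w" "\<zero> \<in> S" "S \<subseteq> carrier R" "w \<in> carrier R"
  obtains k a where "k \<in> simple_extension S w" "a \<in> S" "y = k \<otimes> w \<oplus> a"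
  using assms(1)
proof cases
  case zero
  then show ?thesis using that[of \<zero> \<zero>] assms by auto
next
  case (lin k a)
  then show ?thesis using that by auto
qed

locale field_with_subring = field K for K (structure) +
  fixes R :: "'a set"
  assumes R: "subring R K"
begin

lemmas R_closed = subringE[OF R]

lemma R_carrier: "r \<in> R \<Longrightarrow> r \<in> carrier K"
  using R_closed(1) by auto

lemma pow_in_R: "r \<in> R \<Longrightarrow> r [^] (n::nat) \<in> R"
  by (induction n) (use R_closed in auto)

end

text \<open>
  With \<open>C\<^sub>x = {c \<in> R. c x \<in> R}\<close>, assumption \<open>ext\<close> says that \<open>C\<^sub>x \<subseteq> \<surd>C\<^sub>y\<close> implies
  \<open>y \<in> R[x]\<close>; \<open>regular\<close> says that \<open>\<surd>C\<^sub>x\<close> contains \<open>P\<close> or else \<open>P\<close> has an element \<open>p\<close> that is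
  regular modulo \<open>\<surd>C\<^sub>x\<close>, in which case \<open>x \<in> R[p x]\<close>; \<open>finite_rad\<close> says that \<open>P\<close> is the
  radical of a finitely generated ideal, tested only against the ideals \<open>\<surd>C\<^sub>x\<close>.
\<close>

locale local_overring_determined = field_with_subring +
  fixes P :: "'a set"
  assumes P: "P \<subseteq> R" "\<zero> \<in> P" "\<one> \<notin> P"
    and P_add: "\<lbrakk>p \<in> P; q \<in> P\<rbrakk> \<Longrightarrow> p \<oplus> q \<in> P"
    and P_mult: "\<lbrakk>r \<in> R; p \<in> P\<rbrakk> \<Longrightarrow> r \<otimes> p \<in> P"
    and units: "\<lbrakk>r \<in> R; r \<notin> P\<rbrakk> \<Longrightarrow> inv r \<in> R"
    and frac: "x \<in> carrier K \<Longrightarrow> \<exists>b\<in>R. b \<noteq> \<zero> \<and> b \<otimes> x \<in> R"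
    and ext: "\<lbrakk>x \<in> carrier K; y \<in> carrier K;
        \<And>c. \<lbrakk>c \<in> R; c \<otimes> x \<in> R\<rbrakk> \<Longrightarrow> \<exists>n::nat. c [^] n \<otimes> y \<in> R\<rbrakk> \<Longrightarrow> y \<in> simple_extension R x"
    and regular: "x \<in> carrier K \<Longrightarrow> (\<forall>p\<in>P. \<exists>n::nat. p [^] n \<otimes> x \<in> R) \<or>
        (\<exists>p\<in>P. \<forall>c\<in>R. c \<otimes> (p \<otimes> x) \<in> R \<longrightarrow> (\<exists>n::nat. c [^] n \<otimes> x \<in> R))"
    and finite_rad: "\<exists>J. finite J \<and> J \<subseteq> P \<and> (\<forall>x\<in>carrier K.
        (\<forall>j\<in>J. \<exists>n::nat. j [^] n \<otimes> x \<in> R) \<longrightarrow> (\<forall>p\<in>P. \<exists>n::nat. p [^] n \<otimes> x \<in> R))"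
begin

section \<open>The local ring and the ideal transform of its maximal ideal\<close>

lemma P_carrier: "p \<in> P \<Longrightarrow> p \<in> carrier K"
  using P R_closed(1) by auto

lemma one_minus_notin_P:
  assumes "p \<in> P" shows "\<one> \<ominus> p \<in> R" "\<one> \<ominus> p \<notin> P"
proof -
  have pR: "p \<in> R" "p \<in> carrier K" using assms P(1) P_carrier by auto
  show "\<one> \<ominus> p \<in> R" using R_closed(7)[OF R_closed(3) R_closed(5)[OF pR(1)]] by (simp add: a_minus_def)
  have "\<one> = (\<one> \<ominus> p) \<oplus> p" using pR by algebra
  then show "\<one> \<ominus> p \<notin> P" using P_add[OF _ assms] P(3) by metis
qed

lemma unit_inverse:
  assumes "r \<in> R" "r \<notin> P" shows "inv r \<in> R" "inv r \<otimes> r = \<one>" "r \<otimes> inv r = \<one>"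
proof -
  have "r \<in> carrier K" "r \<noteq> \<zero>" using assms P(2) R_carrier by auto
  then show "inv r \<in> R" "inv r \<otimes> r = \<one>" "r \<otimes> inv r = \<one>" using inv_nonzero units assms by auto
qed

lemma one_minus_inverse:
  assumes "p \<in> P" shows "\<exists>v\<in>R. v \<otimes> (\<one> \<ominus> p) = \<one>"
  using unit_inverse one_minus_notin_P[OF assms] by blast

text \<open>The ideal transform of \<open>P\<close>.\<close>

definition T :: "'a set" where
  "T = {t \<in> carrier K. \<forall>p\<in>P. \<exists>n::nat. p [^] n \<otimes> t \<in> R}"

lemma T_carrier: "t \<in> T \<Longrightarrow> t \<in> carrier K"
  unfolding T_def by simp

lemma R_subset_T: "R \<subseteq> T"
proof
  fix r assume "r \<in> R"
  then have "p [^] (0::nat) \<otimes> r \<in> R" for p using R_carrier by simp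
  then show "r \<in> T" unfolding T_def using \<open>r \<in> R\<close> R_carrier by blast
qed

lemma subring_T: "subring T K"
proof (rule subringI)
  show "T \<subseteq> carrier K" using T_carrier by auto
  show "\<one> \<in> T" using R_subset_T R_closed(3) by auto
  fix s t assume s: "s \<in> T" and t: "t \<in> T"
  note sc = T_carrier[OF s] and tc = T_carrier[OF t]
  show "\<ominus> s \<in> T"
  proof -
    have "\<exists>n::nat. p [^] n \<otimes> \<ominus> s \<in> R" if p: "p \<in> P" for p
    proof -
      obtain n :: nat where "p [^] n \<otimes> s \<in> R" using s p unfolding T_def by auto
      then have "\<ominus> (p [^] n \<otimes> s) \<in> R" using R_closed(5) by auto
      then show ?thesis using sc P_carrier[OF p] by (auto simp: r_minus)
    qed
    then show ?thesis unfolding T_def using sc by auto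
  qed
  have nm: "\<exists>(n::nat) (m::nat). p [^] n \<otimes> s \<in> R \<and> p [^] m \<otimes> t \<in> R" if p: "p \<in> P" for p
    using s t p by (simp add: T_def)
  show "s \<otimes> t \<in> T"
  proof -
    have "\<exists>n::nat. p [^] n \<otimes> (s \<otimes> t) \<in> R" if p: "p \<in> P" for p
    proof -
      obtain n m :: nat where "p [^] n \<otimes> s \<in> R" "p [^] m \<otimes> t \<in> R" using nm p by blast
      then have "(p [^] n \<otimes> s) \<otimes> (p [^] m \<otimes> t) \<in> R" using R_closed(6) by auto
      moreover have "(p [^] n \<otimes> s) \<otimes> (p [^] m \<otimes> t) = p [^] (n + m) \<otimes> (s \<otimes> t)"
        using sc tc P_carrier[OF p] by (simp add: nat_pow_mult[symmetric] m_ac)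
      ultimately show ?thesis by auto
    qed
    then show ?thesis unfolding T_def using sc tc by auto
  qed
  show "s \<oplus> t \<in> T"
  proof -
    have "\<exists>n::nat. p [^] n \<otimes> (s \<oplus> t) \<in> R" if p: "p \<in> P" for p
    proof -
      obtain n m :: nat where "p [^] n \<otimes> s \<in> R" "p [^] m \<otimes> t \<in> R" using nm p by blast
      then have "p [^] m \<otimes> (p [^] n \<otimes> s) \<oplus> p [^] n \<otimes> (p [^] m \<otimes> t) \<in> R"
        using R_closed(6,7) pow_in_R p P(1) by auto
      moreover have "p [^] m \<otimes> (p [^] n \<otimes> s) \<oplus> p [^] n \<otimes> (p [^] m \<otimes> t) = p [^] (n + m) \<otimes> (s \<oplus> t)"
        using sc tc P_carrier[OF p] by (simp add: nat_pow_mult[symmetric] r_distr m_ac)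
      ultimately show ?thesis by auto
    qed
    then show ?thesis unfolding T_def using sc tc by auto
  qed
qed

lemmas T_closed = subringE[OF subring_T]

text \<open>A denominator outside \<open>P\<close> would be a unit of \<open>R\<close>, which would
  put \<open>x\<close> into \<open>R\<close>.\<close>

lemma denominator_in_P:
  assumes "x \<in> carrier K" "x \<notin> R" "c \<in> R" "c \<otimes> x \<in> R" shows "c \<in> P"
proof (rule ccontr)
  assume "c \<notin> P"
  note i = unit_inverse[OF assms(3) this]
  have "x = (inv c \<otimes> c) \<otimes> x" using i(2) assms(1) by simp
  also have "\<dots> = inv c \<otimes> (c \<otimes> x)"
    using R_carrier[OF i(1)] R_carrier[OF assms(3)] assms(1) by (rule m_assoc)
  finally have "x = inv c \<otimes> (c \<otimes> x)" .
  then show False using R_closed(6)[OF i(1) assms(4)] assms(2) by simp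
qed

text \<open>All denominators of \<open>x\<close> lie in \<open>P\<close>, and every element of
  \<open>P\<close> has a power that multiplies \<open>t\<close> into \<open>R\<close>; this is the
  premise of \<open>ext\<close>.\<close>

lemma T_subset_simple_extension:
  assumes "x \<in> carrier K" "x \<notin> R" shows "T \<subseteq> simple_extension R x"
proof
  fix t assume "t \<in> T"
  then show "t \<in> simple_extension R x"
    using denominator_in_P[OF assms] by (intro ext[OF assms(1)]) (auto simp: T_def)
qed

lemma simple_extension_smult:
  assumes "x \<in> carrier K" "p \<in> R" "y \<in> simple_extension R (p \<otimes> x)"
  obtains a h where "a \<in> R" "h \<in> simple_extension R x" "y = a \<oplus> p \<otimes> h"
proof -
  have pc: "p \<in> carrier K" using assms R_carrier by auto
  obtain k a where k: "k \<in> simple_extension R (p \<otimes> x)" "a \<in> R" "y = k \<otimes> (p \<otimes> x) \<oplus> a"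
    using simple_extension_split[OF assms(3)] R_closed(1,2) assms pc by auto
  note E = subringE[OF simple_extension_is_subring[OF R assms(1)]]
  have x: "x \<in> simple_extension R x" using simple_extension_mem[OF R assms(1)] .
  have RE: "R \<subseteq> simple_extension R x" using simple_extension_incl[OF R_closed(1) assms(1)] .
  have "simple_extension R (p \<otimes> x) \<subseteq> simple_extension R x"
    using simple_extension_subring_incl[OF simple_extension_is_subring[OF R assms(1)] RE] E(6) x RE assms by auto
  then have kx: "k \<otimes> x \<in> simple_extension R x" using E(6)[OF _ x] k by auto
  have "k \<in> carrier K" using k(1) simple_extension_in_carrier[OF R_closed(1)] pc assms by auto
  then have "y = a \<oplus> p \<otimes> (k \<otimes> x)" using k pc assms R_carrier by (simp add: m_ac a_comm)
  then show ?thesis using that[OF k(2) kx] by simp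
qed

text \<open>By integrality \<open>S[z]\<close> is spanned by finitely many powers of
  \<open>z\<close>. Each of them lies in \<open>R[p z]\<close>, hence in \<open>S + p S[z]\<close>,
  so Nakayama's lemma modulo the submodule \<open>S\<close> puts all of them into
  \<open>S\<close>.\<close>

lemma nakayama_smult:
  assumes S: "subring S K" "R \<subseteq> S" "p \<in> P"
    and inv: "\<And>s. s \<in> S \<Longrightarrow> \<exists>v\<in>S. v \<otimes> (\<one> \<ominus> p \<otimes> s) = \<one>"
    and z: "z \<in> carrier K" "z \<noteq> \<zero>" "z \<in> simple_extension S (inv z)" "z \<in> simple_extension R (p \<otimes> z)"
  shows "z \<in> S"
proof -
  obtain n where n: "simple_extension S z \<subseteq> lincomb S (pows z n)"
    using integral_simple_extension_subset[OF S(1) z(1-3)] .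
  have pR: "p \<in> R" "p \<in> carrier K" using S(3) P(1) P_carrier by auto
  have pz: "p \<otimes> z \<in> carrier K" using pR z by auto
  have Rpz: "subring (simple_extension R (p \<otimes> z)) K" using simple_extension_is_subring[OF R pz] .
  have "pows z n \<subseteq> S"
  proof (rule nakayama[OF S(1) _ inv submod_subring[OF S(1)] finite_pows pows_carrier[OF z(1)]])
    show "p \<in> S" using pR S(2) by auto
    fix g assume "g \<in> pows z n"
    then obtain i :: nat where i: "g = z [^] i" unfolding pows_def by auto
    have "z [^] i \<in> simple_extension R (p \<otimes> z)"
      by (induction i) (use subringE[OF Rpz] z in auto)
    then obtain a h where h: "a \<in> R" "h \<in> simple_extension R z" "g = a \<oplus> p \<otimes> h"
      using simple_extension_smult[OF z(1) pR(1)] i by metis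
    have "h \<in> lincomb S (pows z n)"
      using h(2) n mono_simple_extension[OF S(2), of z] by auto
    then show "\<exists>a\<in>S. \<exists>h\<in>lincomb S (pows z n). g = a \<oplus> p \<otimes> h" using h S(2) by blast
  qed
  then have "lincomb S (pows z n) \<subseteq> S" using lincomb_minimal[OF submod_subring[OF S(1)]] by blast
  then show ?thesis using n simple_extension_mem[OF S(1) z(1)] by auto
qed

section \<open>Refuting a pair \<open>u\<close>, \<open>inv u\<close> outside the local ring\<close>

context
  fixes u
  assumes u: "u \<in> carrier K" "u \<noteq> \<zero>" "u \<notin> R" "inv u \<notin> R"
begin

text \<open>If \<open>inv q\<close> were in \<open>T\<close>, it would lie in both
  \<open>R[u]\<close> and \<open>R[1/u]\<close>, so multiplication by it would preserve a span
  \<open>V\<close> of powers of \<open>u\<close>. Then \<open>V \<subseteq> q V\<close>, and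
  Nakayama's lemma with the zero submodule kills \<open>V\<close>, although
  \<open>\<one> \<in> V\<close>.\<close>

lemma inv_notin_T:
  assumes q: "q \<in> P" "q \<noteq> \<zero>" shows "inv q \<notin> T"
proof
  assume "inv q \<in> T"
  then have "inv q \<in> simple_extension R u" "inv q \<in> simple_extension R (inv u)"
    using T_subset_simple_extension u inv_nonzero(1)[OF u(1,2)] by blast+
  then obtain n where n: "\<And>g. g \<in> pows u n \<Longrightarrow> inv q \<otimes> g \<in> lincomb R (pows u n)"
    using simple_extension_inv_inter_stable[OF R u(1,2)] by metis
  note qi = inv_nonzero[OF P_carrier[OF q(1)] q(2)]
  have "pows u n \<subseteq> {\<zero>}"
  proof (rule nakayama[OF R _ _ _ finite_pows pows_carrier[OF u(1)]])
    show "q \<in> R" using q P by auto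
    show "\<exists>v\<in>R. v \<otimes> (\<one> \<ominus> q \<otimes> s) = \<one>" if "s \<in> R" for s
    proof (rule one_minus_inverse)
      show "q \<otimes> s \<in> P" using P_mult[OF that q(1)] R_carrier[OF that] P_carrier[OF q(1)] by (simp add: m_comm)
    qed
    show "submod R {\<zero>}" unfolding submod_def using R_carrier by auto
    fix g assume g: "g \<in> pows u n"
    then have gc: "g \<in> carrier K" using pows_carrier[OF u(1)] by auto
    have "q \<otimes> (inv q \<otimes> g) = (q \<otimes> inv q) \<otimes> g" using qi(1) gc P_carrier[OF q(1)] by (simp add: m_assoc)
    then have "g = \<zero> \<oplus> q \<otimes> (inv q \<otimes> g)" using qi(2) gc by simp
    then show "\<exists>a\<in>{\<zero>}. \<exists>h\<in>lincomb R (pows u n). g = a \<oplus> q \<otimes> h" using n[OF g] by blast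
  qed
  moreover have "\<one> \<in> pows u n" unfolding pows_def using u(1) by (intro image_eqI[of _ _ 0]) auto
  ultimately show False by auto
qed

text \<open>If \<open>inv t \<notin> R\<close>, then \<open>R[1/t]\<close> contains all of
  \<open>T\<close>. If \<open>inv t \<in> R\<close>, then \<open>inv_notin_T\<close> keeps it out of
  \<open>P\<close>, so it is a unit and \<open>t \<in> R\<close>.\<close>

lemma T_integral:
  assumes "t \<in> T" "t \<noteq> \<zero>" shows "t \<in> simple_extension R (inv t)"
proof -
  have tc: "t \<in> carrier K" using T_carrier assms by auto
  note ti = inv_nonzero[OF tc assms(2)]
  show ?thesis
  proof (cases "inv t \<in> R")
    case True
    have "inv t \<notin> P" using inv_notin_T ti assms by metis
    then have "t \<in> R" using units[OF True] ti by simp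
    then show ?thesis using simple_extension_incl[OF R_closed(1) ti(1)] by auto
  next
    case False
    then show ?thesis using T_subset_simple_extension ti assms by auto
  qed
qed

text \<open>If \<open>p \<otimes> t\<close> were outside \<open>R\<close>, then
  \<open>T \<subseteq> R[p t]\<close> would contain \<open>t\<close>, and integrality with
  Nakayama's lemma would force \<open>t \<in> R\<close>. If it were a unit of \<open>R\<close>, then
  \<open>inv p\<close> would be in \<open>T\<close>.\<close>

lemma P_T_mult:
  assumes p: "p \<in> P" and t: "t \<in> T" shows "p \<otimes> t \<in> P"
proof -
  have tc: "t \<in> carrier K" and pc: "p \<in> carrier K" using T_carrier P_carrier assms by auto
  have ptR: "p \<otimes> t \<in> R"
  proof (rule ccontr)
    assume n: "p \<otimes> t \<notin> R"
    then have "t \<noteq> \<zero>" using pc R_closed(2) by auto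
    have "t \<in> simple_extension R (p \<otimes> t)" using T_subset_simple_extension[OF _ n] tc pc t by auto
    moreover have "\<exists>v\<in>R. v \<otimes> (\<one> \<ominus> p \<otimes> s) = \<one>" if "s \<in> R" for s
      using one_minus_inverse[of "p \<otimes> s"] P_mult[OF that p] R_carrier[OF that] pc by (simp add: m_comm)
    ultimately have "t \<in> R"
      using nakayama_smult[OF R _ p _ tc \<open>t \<noteq> \<zero>\<close> T_integral[OF t \<open>t \<noteq> \<zero>\<close>]] by blast
    then show False using n R_closed(6)[OF _ \<open>t \<in> R\<close>] p P(1) by auto
  qed
  show ?thesis
  proof (rule ccontr)
    assume n: "p \<otimes> t \<notin> P"
    note i = unit_inverse[OF ptR n]
    have "p \<noteq> \<zero>" using n tc P(2) by auto
    have "t \<otimes> inv (p \<otimes> t) \<in> T" using T_closed(6)[OF t] i(1) R_subset_T by auto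
    moreover have "t \<otimes> inv (p \<otimes> t) = inv p"
      using i R_carrier[OF i(1)] tc pc by (intro comm_inv_char[symmetric]) (auto simp: m_assoc)
    ultimately show False using inv_notin_T[OF p \<open>p \<noteq> \<zero>\<close>] by simp
  qed
qed

text \<open>Integrality of \<open>z\<close> over \<open>T\<close> is expressed as
  \<open>z \<in> T[1/z]\<close>. For \<open>z \<notin> T\<close> the element \<open>p\<close> from
  \<open>regular\<close> gives \<open>z \<in> R[p z]\<close>, and \<open>P T \<subseteq> P\<close>
  makes each \<open>\<one> \<ominus> p \<otimes> s\<close> invertible, so Nakayama's lemma applies
  over \<open>T\<close>.\<close>

lemma T_integrally_closed:
  assumes z: "z \<in> carrier K" "z \<noteq> \<zero>" "z \<in> simple_extension T (inv z)"
  shows "z \<in> T"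
proof (rule ccontr)
  assume "z \<notin> T"
  then obtain p where p: "p \<in> P" "\<forall>c\<in>R. c \<otimes> (p \<otimes> z) \<in> R \<longrightarrow> (\<exists>n::nat. c [^] n \<otimes> z \<in> R)"
    using regular[OF z(1)] z(1) unfolding T_def by auto
  have "z \<in> simple_extension R (p \<otimes> z)"
    using p z P_carrier[OF p(1)] by (intro ext) auto
  moreover have "\<exists>v\<in>T. v \<otimes> (\<one> \<ominus> p \<otimes> s) = \<one>" if "s \<in> T" for s
    using one_minus_inverse[OF P_T_mult[OF p(1) that]] R_subset_T by auto
  ultimately have "z \<in> T"
    using nakayama_smult[OF subring_T R_subset_T p(1) _ z] by blast
  then show False using \<open>z \<notin> T\<close> by simp
qed

lemma T_split:
  assumes x: "x \<in> carrier K" "x \<noteq> \<zero>"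
  shows "\<exists>s\<in>T. s \<otimes> x \<in> T \<and> (\<one> \<ominus> s) \<otimes> inv x \<in> T"
proof (cases "x \<in> T")
  case True
  have "(\<one> \<ominus> \<one>) \<otimes> inv x = \<zero>" using inv_nonzero(1)[OF x] by algebra
  then show ?thesis using True T_closed(2,3) x by (intro bexI[of _ \<one>]) auto
next
  case False
  note xi = inv_nonzero[OF x]
  obtain p where p: "p \<in> P" "\<forall>c\<in>R. c \<otimes> (p \<otimes> x) \<in> R \<longrightarrow> (\<exists>n::nat. c [^] n \<otimes> x \<in> R)"
    using regular[OF x(1)] x(1) False unfolding T_def by auto
  note pc = P_carrier[OF p(1)]
  have px: "p \<otimes> x \<in> carrier K" using pc x by simp
  have "x \<in> simple_extension R (p \<otimes> x)" using p(2) px x by (intro ext) auto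
  then obtain k r0 where k: "k \<in> simple_extension R (p \<otimes> x)" "r0 \<in> R" "x = k \<otimes> (p \<otimes> x) \<oplus> r0"
    using simple_extension_split[OF _ R_closed(2,1) px] by metis
  obtain k' r1 where k': "k' \<in> simple_extension R (p \<otimes> x)" "r1 \<in> R" "k = k' \<otimes> (p \<otimes> x) \<oplus> r1"
    using simple_extension_split[OF k(1) R_closed(2,1) px] by metis
  have k'c: "k' \<in> carrier K" using k'(1) simple_extension_in_carrier[OF R_closed(1) px] by auto
  note rc = R_carrier[OF k(2)] R_carrier[OF k'(2)]
  \<comment> \<open>Now \<open>x = r0 + r1 p x + h x\<^sup>2\<close>; with \<open>e = 1 - r1 p\<close>, a unit, and \<open>w = e - x h\<close> we get
    \<open>w x = r0\<close> and \<open>(e - w)/x = h\<close>, and both \<open>w\<close> and \<open>h\<close> are integral over \<open>T\<close>.\<close>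
  define h where "h = k' \<otimes> (p \<otimes> p)"
  define e where "e = \<one> \<ominus> r1 \<otimes> p"
  define w where "w = e \<ominus> x \<otimes> h"
  have c: "h \<in> carrier K" "e \<in> carrier K" "w \<in> carrier K"
    unfolding w_def e_def h_def using rc pc x k'c by auto
  have ER: "subring (simple_extension R x) K" using simple_extension_is_subring[OF R x(1)] .
  note E = subringE[OF ER]
  have xE: "x \<in> simple_extension R x" using simple_extension_mem[OF R x(1)] .
  have RE: "R \<subseteq> simple_extension R x" using simple_extension_incl[OF R_closed(1) x(1)] .
  have pE: "p \<in> simple_extension R x" using RE p P by auto
  have "simple_extension R (p \<otimes> x) \<subseteq> simple_extension R x"
    using simple_extension_subring_incl[OF ER RE] E(6)[OF pE xE] .
  then have hE: "h \<in> simple_extension R x" unfolding h_def using k'(1) E(6) pE by auto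
  have eR: "e \<in> R" "e \<notin> P"
    unfolding e_def using one_minus_notin_P[OF P_mult[OF k'(2) p(1)]] by auto
  then obtain v where v: "v \<in> R" "v \<otimes> e = \<one>" using unit_inverse by blast
  note vc = R_carrier[OF v(1)]
  have wE: "w \<in> simple_extension R x"
    unfolding w_def a_minus_def using E(7)[OF _ E(5)[OF E(6)[OF xE hE]]] eR RE by auto
  have "x = (k' \<otimes> (p \<otimes> x) \<oplus> r1) \<otimes> (p \<otimes> x) \<oplus> r0" using k(3) k'(3) by simp
  also have "\<dots> = x \<otimes> (x \<otimes> h) \<oplus> r1 \<otimes> p \<otimes> x \<oplus> r0" unfolding h_def using k'c rc pc x(1) by algebra
  finally have x_eq: "x \<otimes> (x \<otimes> h) \<oplus> r1 \<otimes> p \<otimes> x \<oplus> r0 = x" by simp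
  have "w \<otimes> x = x \<ominus> (x \<otimes> (x \<otimes> h) \<oplus> r1 \<otimes> p \<otimes> x \<oplus> r0) \<oplus> r0"
    unfolding w_def e_def using c(1) rc pc x(1) by algebra
  also have "\<dots> = r0" unfolding x_eq using x(1) rc by algebra
  finally have wx: "w \<otimes> x = r0" .
  \<comment> \<open>From \<open>w \<otimes> x = r0\<close> one gets
    \<open>x = r0 / w \<in> T[1/w]\<close>, hence \<open>w \<in> R[x] \<subseteq> T[1/w]\<close>,
    which is integrality of \<open>w\<close>.\<close>
  have wT: "w \<in> T"
  proof (cases "w = \<zero>")
    case True
    then show ?thesis using T_closed(2) by simp
  next
    case False
    note wi = inv_nonzero[OF c(3) False]
    have W: "subring (simple_extension T (inv w)) K" using simple_extension_is_subring[OF subring_T wi(1)] .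
    have RW: "T \<subseteq> simple_extension T (inv w)" using simple_extension_incl[OF T_closed(1) wi(1)] .
    have "x = (inv w \<otimes> w) \<otimes> x" using wi x by simp
    also have "\<dots> = inv w \<otimes> r0" using wi(1) c(3) x(1) unfolding wx[symmetric] by (rule m_assoc)
    finally have "x \<in> simple_extension T (inv w)"
      using subringE(6)[OF W] simple_extension_mem[OF subring_T wi(1)] RW R_subset_T k(2) by auto
    then have "simple_extension R x \<subseteq> simple_extension T (inv w)"
      using simple_extension_subring_incl[OF W] RW R_subset_T by blast
    then show ?thesis using T_integrally_closed[OF c(3) False] wE by auto
  qed
  have xh: "x \<otimes> h = e \<ominus> w" unfolding w_def using c x(1) by algebra
  \<comment> \<open>Likewise \<open>x = (e - w) / h\<close>, with \<open>e \<ominus> w\<close>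
    already in \<open>T\<close>, gives \<open>h \<in> R[x] \<subseteq> T[1/h]\<close>.\<close>
  have hT: "h \<in> T"
  proof (cases "h = \<zero>")
    case True
    then show ?thesis using T_closed(2) by simp
  next
    case False
    note hi = inv_nonzero[OF c(1) False]
    have W: "subring (simple_extension T (inv h)) K" using simple_extension_is_subring[OF subring_T hi(1)] .
    have TW: "T \<subseteq> simple_extension T (inv h)" using simple_extension_incl[OF T_closed(1) hi(1)] .
    have "e \<ominus> w \<in> T" unfolding a_minus_def using T_closed(7)[OF _ T_closed(5)[OF wT]] eR R_subset_T by auto
    have "x = x \<otimes> (h \<otimes> inv h)" using hi x by simp
    also have "\<dots> = (e \<ominus> w) \<otimes> inv h" using hi(1) x(1) c(1) by (simp add: m_assoc[symmetric] xh)
    finally have "x \<in> simple_extension T (inv h)"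
      using subringE(6)[OF W] simple_extension_mem[OF subring_T hi(1)] TW \<open>e \<ominus> w \<in> T\<close> by auto
    then have "simple_extension R x \<subseteq> simple_extension T (inv h)"
      using simple_extension_subring_incl[OF W] TW R_subset_T by blast
    then show ?thesis using T_integrally_closed[OF c(1) False] hE by auto
  qed
  \<comment> \<open>Dividing by the unit \<open>e\<close> normalizes the pair:
    \<open>s = v \<otimes> w\<close> satisfies \<open>s x = v r0\<close> and
    \<open>(1 - s) / x = v h\<close>.\<close>
  have vT: "v \<in> T" using v R_subset_T by auto
  have "(v \<otimes> w) \<otimes> x = v \<otimes> r0" using vc c(3) x(1) wx by (simp add: m_assoc)
  moreover have "v \<otimes> r0 \<in> T" using R_closed(6) v(1) k(2) R_subset_T by auto
  moreover have "(\<one> \<ominus> v \<otimes> w) \<otimes> inv x = v \<otimes> h"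
  proof -
    have "(\<one> \<ominus> v \<otimes> w) \<otimes> inv x = (v \<otimes> e \<ominus> v \<otimes> w) \<otimes> inv x" using v by simp
    also have "\<dots> = v \<otimes> (e \<ominus> w) \<otimes> inv x" using vc c xi(1) by algebra
    also have "\<dots> = (v \<otimes> h) \<otimes> (x \<otimes> inv x)" unfolding xh[symmetric] using vc c xi(1) x(1) by (simp add: m_ac)
    finally show ?thesis using xi(2) vc c by simp
  qed
  ultimately show ?thesis using T_closed(6)[OF vT wT] T_closed(6)[OF vT hT] by (intro bexI[of _ "v \<otimes> w"]) auto
qed

lemma no_nonvaluation_element: False
proof -
  obtain J where J: "finite J" "J \<subseteq> P"
    "\<And>x. x \<in> carrier K \<Longrightarrow> (\<And>j. j \<in> J \<Longrightarrow> \<exists>n::nat. j [^] n \<otimes> x \<in> R) \<Longrightarrow> x \<in> T"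
    using finite_rad unfolding T_def by auto
  have J0: "\<exists>n::nat. \<zero> [^] n \<otimes> x \<in> R" if "x \<in> carrier K" for x
    using that R_closed(2) by (intro exI[of _ 1]) auto
  define J' where "J' = J - {\<zero>}"
  \<comment> \<open>If \<open>J\<close> had no nonzero element, \<open>T\<close> would be the whole
    field and would contain the inverse of a denominator \<open>b \<in> P\<close> of
    \<open>u\<close>.\<close>
  have "J' \<noteq> {}"
  proof
    assume "J' = {}"
    then have all: "x \<in> T" if "x \<in> carrier K" for x
      using J(3)[OF that] J0[OF that] unfolding J'_def by blast
    obtain b where b: "b \<in> R" "b \<noteq> \<zero>" "b \<otimes> u \<in> R" using frac[OF u(1)] by auto
    then have "b \<in> P" using denominator_in_P u by auto
    then show False using inv_notin_T[OF _ b(2)] all inv_nonzero(1)[OF P_carrier b(2)] by auto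
  qed
  moreover have "finite J'" "J' \<subseteq> carrier K - {\<zero>}" unfolding J'_def using J P_carrier by auto
  ultimately have "\<one> \<in> J' \<cdot> fractional_inverse K T J'"
    using one_in_prod_fractional_inverse[OF subring_T T_split] by blast
  moreover have "x \<in> P" if "x \<in> J' \<cdot> fractional_inverse K T J'" for x
    using that
  proof induction
    case (prod j b)
    then have jP: "j \<in> P" using J unfolding J'_def by auto
    have b: "b \<in> carrier K" "\<And>j. j \<in> J' \<Longrightarrow> b \<otimes> j \<in> T" using prod(2) unfolding fractional_inverse_def by auto
    \<comment> \<open>Here \<open>(T : J') \<subseteq> T\<close>: if \<open>i [^] n\<close> moves
      \<open>b \<otimes> i\<close> into \<open>R\<close>, then \<open>i [^] Suc n\<close> moves
      \<open>b\<close> into \<open>R\<close>. The product thus lies in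
      \<open>P T \<subseteq> P\<close>.\<close>
    have "b \<in> T"
    proof (rule J(3)[OF b(1)])
      fix i assume i: "i \<in> J"
      show "\<exists>n::nat. i [^] n \<otimes> b \<in> R"
      proof (cases "i = \<zero>")
        case True
        then show ?thesis using J0[OF b(1)] by simp
      next
        case False
        then have "b \<otimes> i \<in> T" "i \<in> P" using b(2) i J(2) unfolding J'_def by auto
        then obtain n :: nat where "i [^] n \<otimes> (b \<otimes> i) \<in> R" unfolding T_def by auto
        then have "i [^] Suc n \<otimes> b \<in> R" using b(1) P_carrier[OF \<open>i \<in> P\<close>] by (simp add: m_ac)
        then show ?thesis by blast
      qed
    qed
    then show ?case using P_T_mult[OF jP] by simp
  next
    case (sum s1 s2)
    then show ?case using P_add by simp
  qed
  ultimately show False using P(3) by blast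
qed

end

lemma valuation_dichotomy:
  assumes "x \<in> carrier K" "x \<noteq> \<zero>" shows "x \<in> R \<or> inv x \<in> R"
  using no_nonvaluation_element assms by blast

end

section \<open>Localization and the global statement\<close>

context field_with_subring
begin

section \<open>Ideals of the subring seen inside the field\<close>

abbreviation S where "S \<equiv> K\<lparr>carrier := R\<rparr>"

lemma cring_S: "cring S"
  using subcringI'[OF R] subcring_iff[OF R_closed(1)] by simp

lemma pow_S: "x [^]\<^bsub>S\<^esub> (n::nat) = x [^] n"
  using nat_pow_consistent by simp

lemma ideal_SD:
  assumes "ideal I S"
  shows "I \<subseteq> R" "\<zero> \<in> I" "\<lbrakk>a \<in> I; b \<in> I\<rbrakk> \<Longrightarrow> a \<oplus> b \<in> I" "\<lbrakk>r \<in> R; a \<in> I\<rbrakk> \<Longrightarrow> r \<otimes> a \<in> I"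
proof -
  interpret I: ideal I S by fact
  show "I \<subseteq> R" using I.a_subset by simp
  show "\<zero> \<in> I" using additive_subgroup.zero_closed[OF I.is_additive_subgroup] by simp
  show "a \<oplus> b \<in> I" if "a \<in> I" "b \<in> I" using additive_subgroup.a_closed[OF I.is_additive_subgroup that] by simp
  show "r \<otimes> a \<in> I" if "r \<in> R" "a \<in> I" using I.I_l_closed that by simp
qed

lemma ideal_SI:
  assumes "I \<subseteq> R" "\<zero> \<in> I" "\<And>a b. \<lbrakk>a \<in> I; b \<in> I\<rbrakk> \<Longrightarrow> a \<oplus> b \<in> I"
    and "\<And>r a. \<lbrakk>r \<in> R; a \<in> I\<rbrakk> \<Longrightarrow> r \<otimes> a \<in> I"
  shows "ideal I S"
proof (rule idealI)
  interpret S: cring S by (rule cring_S)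
  show "ring S" by (rule S.ring_axioms)
  show "subgroup I (add_monoid S)"
  proof (rule group.subgroupI[OF S.a_group])
    show "I \<subseteq> carrier (add_monoid S)" "I \<noteq> {}" using assms by auto
    fix a b assume a: "a \<in> I" and b: "b \<in> I"
    show "a \<otimes>\<^bsub>add_monoid S\<^esub> b \<in> I" using assms(3) a b by simp
    have aR: "a \<in> R" using a assms(1) by auto
    have "\<ominus> \<one> \<otimes> a \<in> I" using assms(4) R_closed(3,5) a by auto
    then have "\<ominus> a \<in> I" using R_carrier[OF aR] by (simp add: l_minus)
    moreover have "\<ominus> a = \<ominus>\<^bsub>S\<^esub> a"
      using S.minus_equality[of "\<ominus> a" a] aR R_closed(5) R_carrier[OF aR] l_neg by simp
    ultimately show "inv\<^bsub>add_monoid S\<^esub> a \<in> I" by (simp add: a_inv_def)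
  qed
  fix a x assume "a \<in> I" "x \<in> carrier S"
  then show "x \<otimes>\<^bsub>S\<^esub> a \<in> I" "a \<otimes>\<^bsub>S\<^esub> x \<in> I"
    using assms(1,4) R_carrier m_comm[of a x] by auto
qed

lemma radical_of_S: "radical_of S I = {x \<in> R. \<exists>n::nat. n > 0 \<and> x [^] n \<in> I}"
  unfolding radical_of_def pow_S by simp

text \<open>Applied both with \<open>T = R\<close> and with \<open>T\<close> a localization of
  \<open>R\<close>.\<close>

lemma ideal_denominators:
  assumes T: "subring T K" "R \<subseteq> T" and x: "x \<in> carrier K"
  shows "ideal {r \<in> R. r \<otimes> x \<in> T} S"
proof (rule ideal_SI)
  note T' = subringE[OF T(1)]
  show "\<zero> \<in> {r \<in> R. r \<otimes> x \<in> T}" using R_closed(2) T'(2) x by simp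
  fix a b assume "a \<in> {r \<in> R. r \<otimes> x \<in> T}" "b \<in> {r \<in> R. r \<otimes> x \<in> T}"
  then show "a \<oplus> b \<in> {r \<in> R. r \<otimes> x \<in> T}"
    using R_closed(7) T'(7) x R_carrier by (simp add: l_distr)
next
  note T' = subringE[OF T(1)]
  fix r a assume "r \<in> R" "a \<in> {r \<in> R. r \<otimes> x \<in> T}"
  then show "r \<otimes> a \<in> {r \<in> R. r \<otimes> x \<in> T}"
    using R_closed(6) T'(6)[of r "a \<otimes> x"] T(2) x R_carrier by (auto simp: m_assoc)
qed auto

end

section \<open>Localization at a prime ideal\<close>

locale localized_subring = field_with_subring +
  fixes M :: "'a set"
  assumes M: "primeideal M S"
begin

lemmas M_closed = ideal_SD[OF primeideal.axioms(1)[OF M]]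

lemma M_complement:
  shows "\<one> \<in> R - M" "\<lbrakk>s \<in> R - M; t \<in> R - M\<rbrakk> \<Longrightarrow> s \<otimes> t \<in> R - M" "s \<in> R - M \<Longrightarrow> s [^] (n::nat) \<in> R - M"
proof -
  interpret M: primeideal M S by (rule M)
  show 1: "\<one> \<in> R - M" using M.I_notcarr M.one_imp_carrier R_closed(3) by auto
  show 2: "s \<otimes> t \<in> R - M" if "s \<in> R - M" "t \<in> R - M" for s t
    using M.I_prime[of s t] that R_closed(6) by auto
  show "s [^] n \<in> R - M" if "s \<in> R - M" for n :: nat
    by (induction n) (use 1 2 that in simp_all)
qed

lemma M_complement_nonzero: "s \<in> R - M \<Longrightarrow> s \<in> carrier K \<and> s \<noteq> \<zero>"
  using M_closed(2) R_carrier by auto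

abbreviation L where "L \<equiv> localization_at K R M"

lemma localization_iff: "x \<in> L \<longleftrightarrow> x \<in> carrier K \<and> (\<exists>s\<in>R - M. s \<otimes> x \<in> R)"
proof
  assume "x \<in> L"
  then obtain a s where as: "a \<in> R" "s \<in> R - M" "x = a \<otimes> inv s" unfolding localization_at_def by auto
  have sc: "s \<in> carrier K" "s \<noteq> \<zero>" using M_complement_nonzero as by auto
  note i = inv_nonzero[OF sc]
  have "s \<otimes> x = a \<otimes> (s \<otimes> inv s)" using as i(1) sc R_carrier by (simp add: m_lcomm)
  then have "s \<otimes> x \<in> R" using i as R_carrier by simp
  then show "x \<in> carrier K \<and> (\<exists>s\<in>R - M. s \<otimes> x \<in> R)" using as i R_carrier by auto
next
  assume "x \<in> carrier K \<and> (\<exists>s\<in>R - M. s \<otimes> x \<in> R)"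
  then obtain s where s: "x \<in> carrier K" "s \<in> R - M" "s \<otimes> x \<in> R" by auto
  have sc: "s \<in> carrier K" "s \<noteq> \<zero>" using M_complement_nonzero s by auto
  note i = inv_nonzero[OF sc]
  have "(s \<otimes> x) \<otimes> inv s = x \<otimes> (s \<otimes> inv s)" using s sc i(1) by (simp add: m_ac)
  then have "x = (s \<otimes> x) \<otimes> inv s" using i s by simp
  then show "x \<in> L" using s unfolding localization_at_def by blast
qed

lemma R_subset_L: "R \<subseteq> L"
proof
  fix r assume r: "r \<in> R"
  then have "\<one> \<otimes> r \<in> R" using R_carrier by simp
  then show "r \<in> L" using M_complement(1) R_carrier[OF r] unfolding localization_iff by blast
qed

lemma subring_L: "subring L K"
proof (rule subringI)
  show "L \<subseteq> carrier K" using localization_iff by auto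
  show "\<one> \<in> L" using R_subset_L R_closed(3) by auto
  fix x y assume "x \<in> L" "y \<in> L"
  then obtain s t where s: "x \<in> carrier K" "s \<in> R - M" "s \<otimes> x \<in> R"
    and t: "y \<in> carrier K" "t \<in> R - M" "t \<otimes> y \<in> R" unfolding localization_iff by auto
  have c: "s \<in> carrier K" "t \<in> carrier K" "s \<in> R" "t \<in> R" using s t R_carrier by auto
  note st = M_complement(2)[OF s(2) t(2)]
  have "s \<otimes> \<ominus> x = \<ominus> (s \<otimes> x)" using s c by (simp add: r_minus)
  then have "s \<otimes> \<ominus> x \<in> R" using R_closed(5)[OF s(3)] by simp
  then show "\<ominus> x \<in> L" using s unfolding localization_iff by auto
  have "s \<otimes> t \<otimes> (x \<otimes> y) = (s \<otimes> x) \<otimes> (t \<otimes> y)" using s t c by (simp add: m_ac)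
  then have "s \<otimes> t \<otimes> (x \<otimes> y) \<in> R" using R_closed(6)[OF s(3) t(3)] by simp
  then show "x \<otimes> y \<in> L" using st s(1) t(1) unfolding localization_iff by blast
  have "s \<otimes> t \<otimes> (x \<oplus> y) = t \<otimes> (s \<otimes> x) \<oplus> s \<otimes> (t \<otimes> y)" using s(1) t(1) c by algebra
  then have "s \<otimes> t \<otimes> (x \<oplus> y) \<in> R"
    using R_closed(7)[OF R_closed(6)[OF c(4) s(3)] R_closed(6)[OF c(3) t(3)]] by simp
  then show "x \<oplus> y \<in> L" using st s(1) t(1) unfolding localization_iff by blast
qed

lemmas L_closed = subringE[OF subring_L]

lemma inv_in_L: assumes "s \<in> R - M" shows "inv s \<in> L"
proof -
  have "s \<in> carrier K" "s \<noteq> \<zero>" using M_complement_nonzero assms by auto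
  note i = inv_nonzero[OF this]
  have "s \<otimes> inv s \<in> R" using i R_closed by simp
  then show ?thesis unfolding localization_iff using assms i by blast
qed

lemma L_cancel:
  assumes "s \<in> R - M" "y \<in> carrier K" "s \<otimes> y \<in> L" shows "y \<in> L"
proof -
  have s: "s \<in> carrier K" "s \<noteq> \<zero>" using M_complement_nonzero assms by auto
  note i = inv_nonzero[OF s]
  have "y = (inv s \<otimes> s) \<otimes> y" using i(3) assms by simp
  also have "\<dots> = inv s \<otimes> (s \<otimes> y)" using i(1) s(1) assms(2) by (rule m_assoc)
  also have "\<dots> \<in> L" using L_closed(6) inv_in_L assms by blast
  finally show ?thesis .
qed

lemma L_pow_cancel:
  assumes "s \<in> R - M" "p \<in> carrier K" "x \<in> carrier K" "(s \<otimes> p) [^] (n::nat) \<otimes> x \<in> L"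
  shows "p [^] n \<otimes> x \<in> L"
proof (rule L_cancel[OF M_complement(3)[OF assms(1)]])
  have "s \<in> carrier K" using assms M_complement_nonzero by auto
  then show "s [^] n \<otimes> (p [^] n \<otimes> x) \<in> L"
    using assms by (simp add: nat_pow_distrib m_assoc)
qed (use assms in auto)

text \<open>The extension of \<open>M\<close> to \<open>L\<close>, that is, the maximal ideal of the
  local ring \<open>L\<close>, written by clearing a denominator outside \<open>M\<close>.\<close>

definition PL where "PL = {x \<in> carrier K. \<exists>s\<in>R - M. s \<otimes> x \<in> M}"

lemma M_subset_PL: "M \<subseteq> PL"
proof
  fix m assume m: "m \<in> M"
  then have mc: "m \<in> carrier K" using M_closed(1) R_carrier by auto
  then have "\<one> \<otimes> m \<in> M" using m by simp
  then show "m \<in> PL" using M_complement(1) mc unfolding PL_def by blast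
qed

lemma PL_ideal:
  shows "PL \<subseteq> L" "\<zero> \<in> PL" "\<one> \<notin> PL" "\<lbrakk>p \<in> PL; q \<in> PL\<rbrakk> \<Longrightarrow> p \<oplus> q \<in> PL"
    "\<lbrakk>r \<in> L; p \<in> PL\<rbrakk> \<Longrightarrow> r \<otimes> p \<in> PL"
proof -
  show "PL \<subseteq> L" using M_closed(1) unfolding PL_def by (fastforce simp: localization_iff)
  show "\<zero> \<in> PL" using M_closed(2) M_subset_PL by auto
  show "\<one> \<notin> PL" using M_complement_nonzero unfolding PL_def by auto
  show "p \<oplus> q \<in> PL" if p: "p \<in> PL" and q: "q \<in> PL"
  proof -
    obtain s t where s: "p \<in> carrier K" "s \<in> R - M" "s \<otimes> p \<in> M"
      and t: "q \<in> carrier K" "t \<in> R - M" "t \<otimes> q \<in> M" using p q unfolding PL_def by auto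
    have c: "s \<in> carrier K" "t \<in> carrier K" "s \<in> R" "t \<in> R" using s t R_carrier by auto
    have "s \<otimes> t \<otimes> (p \<oplus> q) = t \<otimes> (s \<otimes> p) \<oplus> s \<otimes> (t \<otimes> q)" using s(1) t(1) c by algebra
    then have "s \<otimes> t \<otimes> (p \<oplus> q) \<in> M"
      using M_closed(3)[OF M_closed(4)[OF c(4) s(3)] M_closed(4)[OF c(3) t(3)]] by simp
    then show ?thesis using M_complement(2)[OF s(2) t(2)] s(1) t(1) unfolding PL_def by blast
  qed
  show "r \<otimes> p \<in> PL" if r: "r \<in> L" and p: "p \<in> PL"
  proof -
    obtain s t where s: "p \<in> carrier K" "s \<in> R - M" "s \<otimes> p \<in> M"
      and t: "r \<in> carrier K" "t \<in> R - M" "t \<otimes> r \<in> R" using r p unfolding PL_def localization_iff by auto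
    have c: "s \<in> carrier K" "t \<in> carrier K" using s t R_carrier by auto
    have "s \<otimes> t \<otimes> (r \<otimes> p) = (t \<otimes> r) \<otimes> (s \<otimes> p)" using s(1) t(1) c by (simp add: m_ac)
    then have "s \<otimes> t \<otimes> (r \<otimes> p) \<in> M" using M_closed(4)[OF t(3) s(3)] by simp
    then show ?thesis using M_complement(2)[OF s(2) t(2)] s(1) t(1) unfolding PL_def by blast
  qed
qed

text \<open>If \<open>s\<close> is a denominator of \<open>r\<close>, then
  \<open>s \<otimes> r\<close> is outside \<open>M\<close> because \<open>r \<notin> PL\<close>, and
  it serves as a denominator of \<open>inv r\<close>.\<close>

lemma PL_units: assumes "r \<in> L" "r \<notin> PL" shows "inv r \<in> L"
proof -
  obtain s where s: "r \<in> carrier K" "s \<in> R - M" "s \<otimes> r \<in> R" using assms localization_iff by auto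
  then have sr: "s \<otimes> r \<in> R - M" using assms unfolding PL_def by auto
  have "r \<noteq> \<zero>" using assms PL_ideal(2) by auto
  note i = inv_nonzero[OF s(1) this]
  have sc: "s \<in> carrier K" using s R_carrier by auto
  have "s \<otimes> r \<otimes> inv r = s \<otimes> (r \<otimes> inv r)" using sc s(1) i(1) by (rule m_assoc)
  then have "s \<otimes> r \<otimes> inv r \<in> R" using i(2) sc s by simp
  then show ?thesis using sr i(1) unfolding localization_iff by blast
qed

text \<open>The contraction to \<open>R\<close> of the radical of \<open>(L : x)\<close>. Working
  with an ideal of \<open>R\<close> lets the chain condition of \<open>R\<close> apply directly,
  without a transfer to \<open>L\<close>.\<close>

definition denom_radical where
  "denom_radical x = radical_of S {r \<in> R. r \<otimes> x \<in> L}"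

text \<open>The radical asks for a positive exponent, whereas exponent zero is allowed here; one
  more factor \<open>r\<close> bridges the gap.\<close>

lemma denom_radical_iff: "x \<in> carrier K \<Longrightarrow> r \<in> denom_radical x \<longleftrightarrow> r \<in> R \<and> (\<exists>n::nat. r [^] n \<otimes> x \<in> L)"
proof -
  assume x: "x \<in> carrier K"
  have "\<exists>n::nat. n > 0 \<and> r [^] n \<otimes> x \<in> L" if "r \<in> R" "r [^] (n::nat) \<otimes> x \<in> L" for n
  proof -
    have "r \<otimes> (r [^] n \<otimes> x) \<in> L" using that R_subset_L L_closed(6) by auto
    then have "r [^] Suc n \<otimes> x \<in> L" using x R_carrier[OF that(1)]
      by (simp add: m_assoc[symmetric] nat_pow_comm) (simp add: m_comm)
    then show ?thesis by blast
  qed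
  then show ?thesis unfolding denom_radical_def radical_of_S using pow_in_R by blast
qed

lemma radical_ideal_denom_radical: "x \<in> carrier K \<Longrightarrow> radical_ideal (denom_radical x) S"
  unfolding denom_radical_def
  by (intro cring.radical_of_radical_ideal[OF cring_S] ideal_denominators subring_L R_subset_L)

lemma M_subset_denom_radical:
  assumes x: "x \<in> carrier K" and sub: "M \<subseteq> denom_radical x" and p: "p \<in> PL"
  shows "\<exists>n::nat. p [^] n \<otimes> x \<in> L"
proof -
  obtain s where s: "p \<in> carrier K" "s \<in> R - M" "s \<otimes> p \<in> M" using p unfolding PL_def by auto
  then obtain n :: nat where "(s \<otimes> p) [^] n \<otimes> x \<in> L" using sub denom_radical_iff[OF x] by blast
  then show ?thesis using L_pow_cancel[OF s(2,1) x] by blast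
qed

end

section \<open>Passage between the ring and its localizations\<close>

text \<open>Assumption \<open>ext\<close> is the form in which the sQQR property is used. It does
  not mention prime ideals, and in the presence of \<open>ns\<close> it passes to
  localizations.\<close>

locale overring_determined = field_with_subring +
  assumes frac: "x \<in> carrier K \<Longrightarrow> \<exists>b\<in>R. b \<noteq> \<zero> \<and> b \<otimes> x \<in> R"
    and ext: "\<lbrakk>x \<in> carrier K; y \<in> carrier K;
        \<And>c. \<lbrakk>c \<in> R; c \<otimes> x \<in> R\<rbrakk> \<Longrightarrow> \<exists>n::nat. c [^] n \<otimes> y \<in> R\<rbrakk> \<Longrightarrow> y \<in> simple_extension R x"
    and ns: "noetherian_spectrum S"
begin

lemma local_overring_determined_localization:
  assumes max: "maximalideal M S"
  obtains P where "local_overring_determined K (localization_at K R M) P"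
proof -
  interpret S: cring S by (rule cring_S)
  have Mp: "primeideal M S" using S.maximalideal_prime[OF max] .
  interpret localized_subring K R M
    by (rule localized_subring.intro[OF field_with_subring_axioms localized_subring_axioms.intro[OF Mp]])
  have "local_overring_determined K L PL"
  proof (intro local_overring_determined.intro local_overring_determined_axioms.intro
      field_with_subring.intro[OF field_axioms field_with_subring_axioms.intro[OF subring_L]])
    show "PL \<subseteq> L" "\<zero> \<in> PL" "\<one> \<notin> PL" using PL_ideal by auto
    show "p \<oplus> q \<in> PL" if "p \<in> PL" "q \<in> PL" for p q using PL_ideal(4) that .
    show "r \<otimes> p \<in> PL" if "r \<in> L" "p \<in> PL" for r p using PL_ideal(5) that .
    show "inv r \<in> L" if "r \<in> L" "r \<notin> PL" for r using PL_units that .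
    show "\<exists>b\<in>L. b \<noteq> \<zero> \<and> b \<otimes> x \<in> L" if "x \<in> carrier K" for x
      using frac[OF that] R_subset_L by blast
    show "y \<in> simple_extension L x"
      if x: "x \<in> carrier K" and y: "y \<in> carrier K"
        and den: "\<And>c. c \<in> L \<Longrightarrow> c \<otimes> x \<in> L \<Longrightarrow> \<exists>n::nat. c [^] n \<otimes> y \<in> L" for x y
    proof -
      define C where "C = {r \<in> R. r \<otimes> x \<in> R}"
      have C: "ideal C S" unfolding C_def by (intro ideal_denominators R subset_refl x)
      \<comment> \<open>Up to radical, finitely many denominators of \<open>x\<close> generate all
        of them, so only finitely many fractions have to be cleared.\<close>
      obtain J where J: "finite J" "J \<subseteq> C" "C \<subseteq> radical_of S (Idl\<^bsub>S\<^esub> J)"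
        using S.noetherian_spectrum_finite_radical[OF ns C] .
      have pow: "\<exists>n::nat. \<exists>s\<in>R - M. s \<otimes> (j [^] n \<otimes> y) \<in> R" if j: "j \<in> J" for j
      proof -
        have "j \<in> L" "j \<otimes> x \<in> L" using j J(2) R_subset_L unfolding C_def by auto
        then obtain n :: nat where "j [^] n \<otimes> y \<in> L" using den by blast
        then show ?thesis unfolding localization_iff by blast
      qed
      \<comment> \<open>A common \<open>s\<close> outside \<open>M\<close> is obtained as a product
        with one factor for each element of \<open>J\<close>.\<close>
      have "\<exists>s\<in>R - M. \<forall>j\<in>J. \<exists>n::nat. j [^] n \<otimes> (s \<otimes> y) \<in> R"
        using J(1,2) pow
      proof (induction J)
        case empty
        then show ?case using M_complement(1) by auto
      next
        case (insert j J)
        then obtain s where s: "s \<in> R - M" "\<And>j. j \<in> J \<Longrightarrow> \<exists>n::nat. j [^] n \<otimes> (s \<otimes> y) \<in> R" by auto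
        obtain n :: nat and t where t: "t \<in> R - M" "t \<otimes> (j [^] n \<otimes> y) \<in> R"
          using insert.prems(2)[of j] by auto
        have st: "s \<in> R" "t \<in> R" "s \<in> carrier K" "t \<in> carrier K" using s t R_carrier by auto
        have Jc: "i \<in> carrier K" if "i \<in> insert j J" for i
          using insert.prems(1) that R_carrier unfolding C_def by auto
        have "\<exists>n::nat. i [^] n \<otimes> (s \<otimes> t \<otimes> y) \<in> R" if i: "i \<in> insert j J" for i
        proof (cases "i \<in> J")
          case True
          then obtain m :: nat where "i [^] m \<otimes> (s \<otimes> y) \<in> R" using s by auto
          then have "t \<otimes> (i [^] m \<otimes> (s \<otimes> y)) \<in> R" using R_closed(6) st by auto
          moreover have "t \<otimes> (i [^] m \<otimes> (s \<otimes> y)) = i [^] m \<otimes> (s \<otimes> t \<otimes> y)"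
            using Jc[OF i] st y by (simp add: m_ac)
          ultimately show ?thesis by auto
        next
          case False
          then have "i = j" using i by simp
          have "s \<otimes> (t \<otimes> (j [^] n \<otimes> y)) \<in> R" using R_closed(6) st t by auto
          moreover have "s \<otimes> (t \<otimes> (j [^] n \<otimes> y)) = i [^] n \<otimes> (s \<otimes> t \<otimes> y)"
            using Jc[OF i] st y \<open>i = j\<close> by (simp add: m_ac)
          ultimately show ?thesis by auto
        qed
        then show ?case using M_complement(2)[OF s(1) t(1)] by blast
      qed
      then obtain s where s: "s \<in> R - M" "\<And>j. j \<in> J \<Longrightarrow> \<exists>n::nat. j [^] n \<otimes> (s \<otimes> y) \<in> R" by auto
      have sc: "s \<in> carrier K" "s \<noteq> \<zero>" using M_complement_nonzero[OF s(1)] by auto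
      have sy: "s \<otimes> y \<in> carrier K" using sc y by simp
      define D where "D = radical_of S {r \<in> R. r \<otimes> (s \<otimes> y) \<in> R}"
      have D: "radical_ideal D S"
        unfolding D_def by (intro S.radical_of_radical_ideal ideal_denominators R subset_refl sy)
      have "J \<subseteq> D"
      proof
        fix j assume j: "j \<in> J"
        then obtain n :: nat where n: "j [^] n \<otimes> (s \<otimes> y) \<in> R" using s by auto
        have jR: "j \<in> R" using j J(2) unfolding C_def by auto
        have "j [^] Suc n \<otimes> (s \<otimes> y) = j \<otimes> (j [^] n \<otimes> (s \<otimes> y))"
          using R_carrier[OF jR] sc y by (simp add: m_ac)
        then have "j [^] Suc n \<otimes> (s \<otimes> y) \<in> R" using R_closed(6)[OF jR n] by simp
        moreover have "j [^] Suc n \<in> R" using pow_in_R[OF jR] .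
        ultimately show "j \<in> D" unfolding D_def radical_of_S using jR by blast
      qed
      \<comment> \<open>The radical ideal \<open>D\<close> contains \<open>J\<close>, hence all of
        \<open>C\<close>. So \<open>ext\<close> in \<open>R\<close> yields
        \<open>s \<otimes> y \<in> R[x]\<close>, and \<open>s\<close> is invertible in
        \<open>L\<close>.\<close>
      then have "Idl\<^bsub>S\<^esub> J \<subseteq> D" using S.genideal_minimal D unfolding radical_ideal_def by blast
      then have "C \<subseteq> D" using S.radical_of_minimal[OF D] J(3) by blast
      then have "s \<otimes> y \<in> simple_extension R x"
        by (intro ext[OF x sy]) (auto simp: C_def D_def radical_of_S)
      then have "s \<otimes> y \<in> simple_extension L x" using mono_simple_extension[OF R_subset_L] by auto
      moreover have "inv s \<in> simple_extension L x"
        using simple_extension_incl[OF L_closed(1) x] inv_in_L[OF s(1)] by auto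
      moreover have "y = inv s \<otimes> (s \<otimes> y)"
        using inv_nonzero[OF sc] sc y by (simp add: m_assoc[symmetric])
      ultimately show ?thesis
        using subringE(6)[OF simple_extension_is_subring[OF subring_L x]] by metis
    qed
    show "(\<forall>p\<in>PL. \<exists>n::nat. p [^] n \<otimes> x \<in> L) \<or>
        (\<exists>p\<in>PL. \<forall>c\<in>L. c \<otimes> (p \<otimes> x) \<in> L \<longrightarrow> (\<exists>n::nat. c [^] n \<otimes> x \<in> L))"
      if x: "x \<in> carrier K" for x
    proof (cases "M \<subseteq> denom_radical x")
      case True
      then show ?thesis using M_subset_denom_radical[OF x] by blast
    next
      case False
      \<comment> \<open>Elements outside \<open>M\<close> cancel modulo
        \<open>denom_radical x\<close>; this is the hypothesis \<open>sat\<close> of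
        \<open>noetherian_spectrum_regular_element\<close>.\<close>
      have "r \<in> denom_radical x"
        if "r \<in> carrier S" "s \<in> carrier S" "s \<notin> M" "s \<otimes>\<^bsub>S\<^esub> r \<in> denom_radical x" for r s
        using that L_pow_cancel[of s r x] R_carrier x unfolding denom_radical_iff[OF x] by auto
      then obtain p where p: "p \<in> M"
          "\<And>r. r \<in> carrier S \<Longrightarrow> r \<otimes>\<^bsub>S\<^esub> p \<in> denom_radical x \<Longrightarrow> r \<in> denom_radical x"
        using S.noetherian_spectrum_regular_element[OF ns max radical_ideal_denom_radical[OF x] False]
        by metis
      have pR: "p \<in> R" "p \<in> carrier K" using p(1) M_closed(1) R_carrier by auto
      have "\<exists>n::nat. c [^] n \<otimes> x \<in> L" if c: "c \<in> L" "c \<otimes> (p \<otimes> x) \<in> L" for c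
      proof -
        obtain s where s: "c \<in> carrier K" "s \<in> R - M" "s \<otimes> c \<in> R" using c localization_iff by auto
        have sL: "s \<in> L" "s \<in> carrier K" using s R_subset_L R_carrier by auto
        \<comment> \<open>Clearing the denominator \<open>s\<close> of \<open>c\<close> moves the
          relation into \<open>R\<close>, where regularity of \<open>p\<close> removes the factor
          \<open>p\<close>; \<open>L_pow_cancel\<close> then removes \<open>s\<close>.\<close>
        have "s \<otimes> (c \<otimes> (p \<otimes> x)) = (s \<otimes> c \<otimes> p) [^] (1::nat) \<otimes> x"
          using s sL pR x by (simp add: m_ac)
        then have "(s \<otimes> c \<otimes> p) [^] (1::nat) \<otimes> x \<in> L" using L_closed(6)[OF sL(1) c(2)] by simp
        then have "s \<otimes> c \<otimes> p \<in> denom_radical x"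
          using denom_radical_iff[OF x] R_closed(6)[OF s(3) pR(1)] by blast
        then have "s \<otimes> c \<in> denom_radical x" using p(2)[of "s \<otimes> c"] s by simp
        then show ?thesis using L_pow_cancel[OF s(2,1) x] denom_radical_iff[OF x] by blast
      qed
      then show ?thesis using p(1) M_subset_PL by blast
    qed
    show "\<exists>J. finite J \<and> J \<subseteq> PL \<and> (\<forall>x\<in>carrier K.
        (\<forall>j\<in>J. \<exists>n::nat. j [^] n \<otimes> x \<in> L) \<longrightarrow> (\<forall>p\<in>PL. \<exists>n::nat. p [^] n \<otimes> x \<in> L))"
    proof -
      \<comment> \<open>A finite set generating \<open>M\<close> up to radical in \<open>R\<close>
        serves for \<open>PL\<close> as well, by way of \<open>denom_radical x\<close>.\<close>
      obtain J where J: "finite J" "J \<subseteq> M" "M \<subseteq> radical_of S (Idl\<^bsub>S\<^esub> J)"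
        using S.noetherian_spectrum_finite_radical[OF ns primeideal.axioms(1)[OF Mp]] .
      have "\<exists>n::nat. p [^] n \<otimes> x \<in> L"
        if x: "x \<in> carrier K" and j: "\<forall>j\<in>J. \<exists>n::nat. j [^] n \<otimes> x \<in> L" and p: "p \<in> PL" for x p
      proof (rule M_subset_denom_radical[OF x _ p])
        note D = radical_ideal_denom_radical[OF x]
        have "J \<subseteq> denom_radical x" using denom_radical_iff[OF x] j J(2) M_closed(1) by auto
        then have "Idl\<^bsub>S\<^esub> J \<subseteq> denom_radical x"
          using S.genideal_minimal D unfolding radical_ideal_def by blast
        then show "M \<subseteq> denom_radical x" using S.radical_of_minimal[OF D] J(3) by blast
      qed
      then show ?thesis using J M_subset_PL by (intro exI[of _ J]) auto
    qed
  qed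
  then show ?thesis using that by blast
qed

text \<open>If the denominator ideals of \<open>x\<close> and \<open>inv x\<close> had a proper sum,
  it would lie in a maximal ideal \<open>M\<close>. But the localization at \<open>M\<close> is a
  valuation ring, so \<open>x\<close> or \<open>inv x\<close> has a denominator outside
  \<open>M\<close>.\<close>

lemma denominators_comaximal:
  assumes x: "x \<in> carrier K" "x \<noteq> \<zero>"
  shows "\<exists>s\<in>R. s \<otimes> x \<in> R \<and> (\<one> \<ominus> s) \<otimes> inv x \<in> R"
proof -
  interpret S: cring S by (rule cring_S)
  note xi = inv_nonzero[OF x]
  define A where "A = {r \<in> R. r \<otimes> x \<in> R}"
  define B where "B = {r \<in> R. r \<otimes> inv x \<in> R}"
  have A: "ideal A S" unfolding A_def by (intro ideal_denominators R subset_refl x)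
  have B: "ideal B S" unfolding B_def by (intro ideal_denominators R subset_refl xi)
  define I where "I = set_add S A B"
  have I: "ideal I S" unfolding I_def using S.add_ideals[OF A B] .
  have I_iff: "I = {a \<oplus> b |a b. a \<in> A \<and> b \<in> B}" unfolding I_def set_add_defs by auto
  have AR: "A \<subseteq> R" "B \<subseteq> R" unfolding A_def B_def by auto
  have AI: "A \<subseteq> I"
  proof
    fix a assume "a \<in> A"
    then have "a = a \<oplus> \<zero>" using AR R_carrier by auto
    then show "a \<in> I" unfolding I_iff using ideal_SD(2)[OF B] \<open>a \<in> A\<close> by blast
  qed
  have BI: "B \<subseteq> I"
  proof
    fix b assume "b \<in> B"
    then have "b = \<zero> \<oplus> b" using AR R_carrier by auto
    then show "b \<in> I" unfolding I_iff using ideal_SD(2)[OF A] \<open>b \<in> B\<close> by blast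
  qed
  have "I = R"
  proof (rule ccontr)
    assume "I \<noteq> R"
    then obtain M where max: "maximalideal M S" "I \<subseteq> M"
      using S.noetherian_spectrum_maximalideal[OF ns I] by auto
    interpret localized_subring K R M
      by (rule localized_subring.intro[OF field_with_subring_axioms localized_subring_axioms.intro[OF S.maximalideal_prime[OF max(1)]]])
    obtain P where "local_overring_determined K L P"
      using local_overring_determined_localization[OF max(1)] .
    then have "x \<in> L \<or> inv x \<in> L" using local_overring_determined.valuation_dichotomy x by metis
    then show False using AI BI max(2) unfolding localization_iff A_def B_def by blast
  qed
  then obtain s t where st: "\<one> = s \<oplus> t" "s \<in> A" "t \<in> B" using R_closed(3) I_iff by auto
  have c: "s \<in> carrier K" "t \<in> carrier K" using st AR R_carrier by auto
  have "\<one> \<ominus> s = t" unfolding st(1) using c by algebra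
  then show ?thesis using st unfolding A_def B_def by auto
qed

lemma invertible_ideal_genideal:
  assumes A: "finite A" "A \<subseteq> R" "Idl\<^bsub>S\<^esub> A \<noteq> {\<zero>}"
  shows "invertible_ideal K R (Idl\<^bsub>S\<^esub> A)"
proof -
  interpret S: cring S by (rule cring_S)
  define I where "I = Idl\<^bsub>S\<^esub> A"
  have I: "ideal I S" unfolding I_def using S.genideal_ideal A by simp
  have AI: "A \<subseteq> I" unfolding I_def using S.genideal_self A by simp
  note I' = ideal_SD[OF I]
  define A' where "A' = A - {\<zero>}"
  have "A' \<noteq> {}"
  proof
    assume "A' = {}"
    then have "A \<subseteq> {\<zero>}" unfolding A'_def by auto
    then have "I \<subseteq> {\<zero>}" unfolding I_def using S.genideal_minimal[OF S.zeroideal] by simp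
    then show False using A(3) I'(2) unfolding I_def by auto
  qed
  moreover have "finite A'" "A' \<subseteq> carrier K - {\<zero>}" unfolding A'_def using A R_carrier by auto
  ultimately have 1: "\<one> \<in> A' \<cdot> fractional_inverse K R A'"
    using one_in_prod_fractional_inverse[OF R denominators_comaximal] by blast
  \<comment> \<open>The inverse of an ideal is determined by its generators, of which zero imposes
    no condition.\<close>
  have frac_sub: "fractional_inverse K R A' \<subseteq> fractional_inverse K R I"
  proof
    fix b assume "b \<in> fractional_inverse K R A'"
    then have b: "b \<in> carrier K" "\<And>a. a \<in> A' \<Longrightarrow> b \<otimes> a \<in> R" unfolding fractional_inverse_def by auto
    have "b \<otimes> a \<in> R" if "a \<in> A" for a
      using b that R_closed(2) unfolding A'_def by (cases "a = \<zero>") auto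
    then have "a \<otimes> b \<in> R" if "a \<in> A" for a
      using that m_comm[OF R_carrier b(1), of a] A(2) by auto
    then have "A \<subseteq> {r \<in> R. r \<otimes> b \<in> R}" using A(2) by auto
    then have "I \<subseteq> {r \<in> R. r \<otimes> b \<in> R}"
      unfolding I_def by (intro S.genideal_minimal ideal_denominators R subset_refl b(1))
    then show "b \<in> fractional_inverse K R I"
      unfolding fractional_inverse_def using b(1) R_carrier by (auto simp: m_comm)
  qed
  have "I \<cdot> fractional_inverse K R I \<subseteq> R"
  proof
    fix x assume "x \<in> I \<cdot> fractional_inverse K R I"
    then show "x \<in> R"
    proof induction
      case (prod a b)
      then show ?case unfolding fractional_inverse_def using I'(1) R_carrier m_comm[of a b] by auto
    next
      case (sum s1 s2)
      then show ?case using R_closed(7) by simp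
    qed
  qed
  moreover have "r \<in> I \<cdot> fractional_inverse K R I" if r: "r \<in> R" for r
  proof -
    \<comment> \<open>Multiplication by \<open>r\<close> is pushed into the ideal factor of each
      product; the value \<open>x = \<one>\<close> then gives \<open>r\<close> itself.\<close>
    have "x \<in> carrier K \<and> r \<otimes> x \<in> I \<cdot> fractional_inverse K R I" if "x \<in> A' \<cdot> fractional_inverse K R A'" for x
      using that
    proof induction
      case (prod a b)
      have ab: "a \<in> I" "a \<in> carrier K" "b \<in> carrier K" "b \<in> fractional_inverse K R I"
        using prod AI A(2) R_carrier frac_sub unfolding A'_def fractional_inverse_def by auto
      then have "(r \<otimes> a) \<otimes> b \<in> I \<cdot> fractional_inverse K R I"
        using I'(4)[OF r] by (intro ideal_prod.prod) auto
      then show ?case using ab R_carrier[OF r] by (simp add: m_assoc)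
    next
      case (sum s1 s2)
      then show ?case using R_carrier[OF r] by (simp add: r_distr ideal_prod.sum)
    qed
    then show ?thesis using 1 R_carrier[OF r] by force
  qed
  ultimately show ?thesis unfolding invertible_ideal_def I_def by auto
qed

end

text \<open>For each prime \<open>P\<close> of the family that defines \<open>R[x]\<close>, the
  element \<open>x\<close> has a denominator \<open>s\<close> outside \<open>P\<close>. By
  hypothesis some \<open>s [^] n\<close> is a denominator of \<open>y\<close>, again outside
  \<open>P\<close>, so \<open>y\<close> lies in every localization and hence in
  \<open>R[x]\<close>.\<close>

lemma sQQR_domain_overring_determined:
  fixes K (structure)
  assumes "sQQR_domain K R" "noetherian_spectrum (K\<lparr>carrier := R\<rparr>)"
  shows "overring_determined K R"
proof -
  have dq: "field K" "subring R K"
    and fr: "\<And>x. x \<in> carrier K \<Longrightarrow> \<exists>a\<in>R. \<exists>b\<in>R - {\<zero>\<^bsub>K\<^esub>}. x = a \<otimes>\<^bsub>K\<^esub> inv\<^bsub>K\<^esub> b"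
    and ex: "\<And>u. u \<in> carrier K \<Longrightarrow> \<exists>\<P>. (\<forall>P\<in>\<P>. primeideal P (K\<lparr>carrier := R\<rparr>)) \<and>
        ring.simple_extension K R u = carrier K \<inter> (\<Inter>P\<in>\<P>. localization_at K R P)"
    using assms(1) unfolding sQQR_domain_def domain_with_quotient_field_def by auto
  interpret field K by fact
  interpret field_with_subring K R
    by (rule field_with_subring.intro[OF dq(1) field_with_subring_axioms.intro[OF dq(2)]])
  show ?thesis
  proof (intro overring_determined.intro[OF field_with_subring_axioms] overring_determined_axioms.intro)
    show "noetherian_spectrum S" by fact
    fix x assume x: "x \<in> carrier K"
    obtain a b where ab: "a \<in> R" "b \<in> R" "b \<noteq> \<zero>" "x = a \<otimes> inv b" using fr[OF x] by auto
    have bc: "b \<in> carrier K" using ab R_carrier by auto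
    note i = inv_nonzero[OF bc ab(3)]
    have "b \<otimes> x = a \<otimes> (b \<otimes> inv b)" using ab R_carrier bc i(1) by (simp add: m_lcomm)
    then show "\<exists>b\<in>R. b \<noteq> \<zero> \<and> b \<otimes> x \<in> R" using ab i R_carrier by (intro bexI[of _ b]) auto
  next
    fix x y assume x: "x \<in> carrier K" and y: "y \<in> carrier K"
      and den: "\<And>c. c \<in> R \<Longrightarrow> c \<otimes> x \<in> R \<Longrightarrow> \<exists>n::nat. c [^] n \<otimes> y \<in> R"
    obtain \<P> where \<P>: "\<And>P. P \<in> \<P> \<Longrightarrow> primeideal P S"
      "simple_extension R x = carrier K \<inter> (\<Inter>P\<in>\<P>. localization_at K R P)"
      using ex[OF x] by auto
    have "y \<in> localization_at K R P" if P: "P \<in> \<P>" for P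
    proof -
      interpret localized_subring K R P
        by (rule localized_subring.intro[OF field_with_subring_axioms localized_subring_axioms.intro[OF \<P>(1)[OF P]]])
      have "x \<in> L" using simple_extension_mem[OF R x] \<P>(2) P by auto
      then obtain s where s: "s \<in> R - P" "s \<otimes> x \<in> R" using localization_iff by auto
      then obtain n :: nat where "s [^] n \<otimes> y \<in> R" using den by auto
      then show "y \<in> L" using M_complement(3)[OF s(1)] y unfolding localization_iff by blast
    qed
    then show "y \<in> simple_extension R x" using \<P>(2) y by auto
  qed
qed

theorem theorem2p17:
  fixes K :: "('a, 'b) ring_scheme" and R :: "'a set"
  assumes "sQQR_domain K R"
    and "noetherian_spectrum (K\<lparr>carrier := R\<rparr>)"
  shows "pruefer_domain K R"
proof -
  interpret overring_determined K R using assms by (rule sQQR_domain_overring_determined)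
  show ?thesis
    using assms(1) invertible_ideal_genideal unfolding pruefer_domain_def sQQR_domain_def by blast
qed

end
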